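(* Let $f$ be an attachment rule and consider the associated preferential attachment network. (i) Let $$\mu_k=\frac1{1+f(k)}\prod_{l=0}^{k-1}\frac{f(l)}{1+f(l)}\qquad\text{for } k\in\mathbb Z_+ .$$ Then $\mu=(\mu_k)_{k\in\mathbb Z_+}$ is a sequence of probability weights, and almost surely $$\lim_{n\to\infty}X(n)=\mu$$ in total variation norm. (ii) If $f$ satisfies $f(k)\le \eta k+1$ for all $k\in\mathbb Z_+$, for some $\eta\in(0,1)$, then the conditional distribution of the outdegree of the $(n+1)$st incoming vertex, given the graph at time $n$, converges almost surely, as $n\to\infty$, in the variation topology to the Poisson distribution with parameter $\lambda:=\langle\mu,f\rangle=\sum_{k\ge0}\mu_k f(k)$.
   Context: $\mathbb Z_+=\{0,1,2,\dots\}$, $\mathbb N=\{1,2,\dots\}$. An attachment rule is a monotonically increasing (nondecreasing) function $f:\mathbb Z_+\to(0,\infty)$ with $f(n)\le n+1$ for all $n\in\mathbb Z_+$. The network evolves as follows: at time $n=1$ it consists of a single vertex, labelled $1$, without edges. In the step $n\to n+1$ a new vertex labelled $n+1$ is added and, independently for each old vertex $m\in\{1,\dots,n\}$ (given the graph at time $n$), a directed edge $n+1\to m$ is inserted with probability $f(\text{indegree of } m \text{ at time } n)/n$. For $m\le n$, $\mathcal Z[m,n]$ denotes the indegree of vertex $m$ after insertion of vertex $n$, and $X_k(n)=\frac1n\sum_{i=1}^n \mathbf 1_{\{\mathcal Z[i,n]=k\}}$, $X(n)=(X_k(n))_{k\in\mathbb Z_+}$ (the empirical indegree distribution at time $n$).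 *)

theory Defs
  imports "HOL-Probability.Probability" "Graph_Theory.Pair_Digraph"
begin

definition attachment_rule :: "(nat \<Rightarrow> real) \<Rightarrow> bool" where
  "attachment_rule f \<longleftrightarrow> mono f \<and> (\<forall>n. 0 < f n) \<and> (\<forall>n. f n \<le> real n + 1)"

text \<open>
  The graph at time \<open>n\<close> is a finite digraph and takes only finitely many values, so
  conditioning on it is elementary conditioning on the events \<open>{G n = g}\<close> of positive probability.
\<close>

definition given_graph ::
  "'w measure \<Rightarrow> (nat \<Rightarrow> 'w \<Rightarrow> nat pair_pre_digraph) \<Rightarrow> nat \<Rightarrow> nat pair_pre_digraph \<Rightarrow> 'w measure"
  where "given_graph M G n g = uniform_measure M {\<omega> \<in> space M. G n \<omega> = g}"

definition arc_event ::
  "'w measure \<Rightarrow> (nat \<Rightarrow> 'w \<Rightarrow> nat pair_pre_digraph) \<Rightarrow> nat \<Rightarrow> nat \<Rightarrow> 'w set"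
  where "arc_event M G n m = {\<omega> \<in> space M. (Suc n, m) \<in> parcs (G (Suc n) \<omega>)}"

text \<open>
  Time starts at 1; the value of \<open>G\<close> at 0 is irrelevant. Arcs point from the newer to the older
  vertex.
\<close>

locale preferential_attachment = prob_space M
  for M :: "'w measure" +
  fixes f :: "nat \<Rightarrow> real"
    and G :: "nat \<Rightarrow> 'w \<Rightarrow> nat pair_pre_digraph"
  assumes measurable_graph: "\<And>n. 1 \<le> n \<Longrightarrow> G n \<in> measurable M (count_space UNIV)"
    and initial_graph: "\<And>\<omega>. \<omega> \<in> space M \<Longrightarrow> G 1 \<omega> = \<lparr>pverts = {1}, parcs = {}\<rparr>"
    and growth: "\<And>n \<omega>. 1 \<le> n \<Longrightarrow> \<omega> \<in> space M \<Longrightarrow>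
      \<exists>A \<subseteq> {1..n}. G (Suc n) \<omega> =
        \<lparr>pverts = insert (Suc n) (pverts (G n \<omega>)), parcs = parcs (G n \<omega>) \<union> {Suc n} \<times> A\<rparr>"
    and indep_arcs: "\<And>n g. 1 \<le> n \<Longrightarrow> 0 < measure M {\<omega> \<in> space M. G n \<omega> = g} \<Longrightarrow>
      prob_space.indep_events (given_graph M G n g) (arc_event M G n) {1..n}"
    and prob_arc: "\<And>n g m. 1 \<le> n \<Longrightarrow> 0 < measure M {\<omega> \<in> space M. G n \<omega> = g} \<Longrightarrow> m \<in> {1..n} \<Longrightarrow>
      measure (given_graph M G n g) (arc_event M G n m) = f (in_degree (with_proj g) m) / real n"

definition indegree :: "(nat \<Rightarrow> 'w \<Rightarrow> nat pair_pre_digraph) \<Rightarrow> nat \<Rightarrow> nat \<Rightarrow> 'w \<Rightarrow> nat" where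
  "indegree G m n \<omega> = in_degree (with_proj (G n \<omega>)) m"

definition empirical_indegree ::
  "(nat \<Rightarrow> 'w \<Rightarrow> nat pair_pre_digraph) \<Rightarrow> nat \<Rightarrow> 'w \<Rightarrow> nat \<Rightarrow> real" where
  "empirical_indegree G n \<omega> k = 1 / real n * (\<Sum>i=1..n. of_bool (indegree G i n \<omega> = k))"

definition outdegree_cond_dist ::
  "'w measure \<Rightarrow> (nat \<Rightarrow> 'w \<Rightarrow> nat pair_pre_digraph) \<Rightarrow> nat \<Rightarrow> 'w \<Rightarrow> nat \<Rightarrow> real" where
  "outdegree_cond_dist M G n \<omega> k =
     measure (given_graph M G n (G n \<omega>))
       {\<omega>' \<in> space M. out_degree (with_proj (G (Suc n) \<omega>')) (Suc n) = k}"

definition limit_weight :: "(nat \<Rightarrow> real) \<Rightarrow> nat \<Rightarrow> real" where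
  "limit_weight f k = 1 / (1 + f k) * (\<Prod>l<k. f l / (1 + f l))"

text \<open>
  Total variation norm of the signed measure on the natural numbers with weights \<open>a\<close>. It is
  extended-real valued, so that it is infinite (rather than 0) when the series diverges.
\<close>

definition tv_norm :: "(nat \<Rightarrow> real) \<Rightarrow> ennreal" where
  "tv_norm a = (\<Sum>k. ennreal \<bar>a k\<bar>)"

end

theory Submission
  imports Defs
begin

text \<open>
Two kinds of functionals of the graph carry the argument: the number \<open>U\<^sub>k(n)\<close> of vertices of
indegree at least \<open>k\<close>, and the excess \<open>R\<^sub>K(n)\<close>, the sum of \<open>(indegree - K)\<close> over the vertices of
indegree at least \<open>K\<close>. Both are nondecreasing in \<open>n\<close>, and both grow in a step by the number of
new arcs into a set of vertices that the current graph determines. Given the graph, that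
increment is a sum of independent indicators, so its variance is at most its mean.

Part (i). Let \<open>t\<^sub>k\<close> be the product of \<open>f l / (1 + f l)\<close> over \<open>l < k\<close>. Since
\<open>t\<^sub>k\<^sub>+\<^sub>1 = f k * (t\<^sub>k - t\<^sub>k\<^sub>+\<^sub>1)\<close>, the sequence \<open>n * t\<^sub>k\<close> solves the recursion for the mean of \<open>U\<^sub>k(n)\<close>
exactly, and the deviation \<open>d\<^sub>k(n) = U\<^sub>k(n) / n - t\<^sub>k\<close> satisfies, by convexity of the square,
\<open>E d\<^sub>k\<^sub>+\<^sub>1(n+1)\<^sup>2 \<le> (1 - (1 + f k) / (n+1)) E d\<^sub>k\<^sub>+\<^sub>1(n)\<^sup>2 + f k / (n+1) E d\<^sub>k(n)\<^sup>2 + f k / (n+1)\<^sup>2\<close>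
(\<open>tail_error_Suc_recursion\<close>). Telescoping such a recursion bounds the sum of
\<open>E d\<^sub>k\<^sub>+\<^sub>1(n)\<^sup>2 / (n+1)\<close> by that of \<open>E d\<^sub>k(n)\<^sup>2 / (n+1)\<close>
(\<open>summable_of_contracting_recursion\<close>), so by induction on \<open>k\<close> these sums are finite, and almost
surely the sum of \<open>d\<^sub>k(n)\<^sup>2 / (n+1)\<close> is finite. A monotone sequence \<open>a\<close> for which \<open>a n / n\<close> is far
from its target at one time stays far from it on an interval \<open>[n, (1 + \<delta>) n]\<close> next to that time, and
such an interval has harmonic mass bounded below; so finiteness of the weighted sum already
forces \<open>d\<^sub>k(n)\<close> to tend to 0 (\<open>eventually_upper_of_weighted_summable\<close> and
\<open>eventually_lower_of_weighted_summable\<close>). Differences of consecutive \<open>U\<^sub>k\<close> give the convergence of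
each \<open>X\<^sub>k(n)\<close> to \<open>t\<^sub>k - t\<^sub>k\<^sub>+\<^sub>1 = \<mu>\<^sub>k\<close>, and Scheffe's lemma turns it into convergence in total variation.

Part (ii). Given the graph, the outdegree of the new vertex is a sum of independent indicators
with probabilities \<open>p\<^sub>m = f (indegree of m) / n\<close>. Replacing the indicators one by one by Poisson
variables shows that its weights differ from those of the Poisson distribution with the same mean
by at most \<open>2 \<Sum> p\<^sub>m\<^sup>2\<close> (\<open>le_Cam_pointwise\<close>). Pointwise convergence suffices, again by
Scheffe's lemma, so it remains to show that almost surely \<open>\<Sum> p\<^sub>m\<close> tends to \<open>\<langle>\<mu>, f\<rangle>\<close> and \<open>\<Sum> p\<^sub>m\<^sup>2\<close>
to 0. Part (i) handles vertices of bounded indegree; the rest is controlled by \<open>R\<^sub>K(n) / n\<close>. When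
\<open>f k \<le> \<eta> * k + 1\<close>, the positive part of \<open>R\<^sub>K(n) / n - c\<^sub>K\<close> with
\<open>c\<^sub>K = (\<eta> * K + 1) * t\<^sub>K / (1 - \<eta>)\<close> obeys a recursion of the kind above that contracts because
\<open>\<eta> < 1\<close> (\<open>excess_recursion\<close>). Hence the upper limit of \<open>R\<^sub>K(n) / n\<close> is at most \<open>c\<^sub>K\<close>, and \<open>c\<^sub>K\<close> tends to
0 as \<open>K\<close> grows because the decreasing sequence \<open>t\<close> is summable.
\<close>

section \<open>Mean-square recursions and almost sure convergence\<close>

text \<open>
Adding up the recursion, \<open>a * v n / (n+1)\<close> is at most the decrease of \<open>v\<close> plus \<open>s n\<close>, and the
decreases telescope. This yields no rate for \<open>v\<close> itself, but weighted summability is what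
passes from expectations to almost every point.
\<close>
lemma summable_of_contracting_recursion:
  fixes v s :: "nat \<Rightarrow> real"
  assumes a: "0 < a" and v: "\<And>n. 0 \<le> v n" and s: "summable s"
    and rec: "\<And>n. start \<le> n \<Longrightarrow> v (Suc n) \<le> (1 - a / real (Suc n)) * v n + s n"
  shows "summable (\<lambda>n. v n / real (Suc n))"
proof -
  define s' where "s' n = s (n + start)" for n
  have s'sum: "summable s'"
    using s by (simp add: s'_def[abs_def] summable_iff_shift)
  obtain B where B: "\<And>N. (\<Sum>i<N. s' i) \<le> B"
    using s'sum by (metis convergent_imp_Bseq summable_iff_convergent Bseq_def abs_le_iff order_trans real_norm_def)
  have "v (N + start) + a * (\<Sum>i<N. v (i + start) / real (Suc (i + start))) \<le> v start + (\<Sum>i<N. s' i)" for N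
  proof (induction N)
    case (Suc N)
    have "v (Suc N + start) + a * (v (N + start) / real (Suc (N + start))) \<le> v (N + start) + s' N"
      using rec[of "N + start"] by (simp add: s'_def algebra_simps)
    then show ?case using Suc.IH by (simp add: algebra_simps)
  qed simp
  then have "a * (\<Sum>i<N. v (i + start) / real (Suc (i + start))) \<le> v start + B" for N
    using B[of N] v[of "N + start"] by (smt (verit))
  then have "(\<Sum>i<N. v (i + start) / real (Suc (i + start))) \<le> (v start + B) / a" for N
    using a by (simp add: field_simps)
  then have "summable (\<lambda>i. v (i + start) / real (Suc (i + start)))"
    using v by (intro summableI_nonneg_bounded) auto
  then show ?thesis by (subst (asm) summable_iff_shift)
qed

text \<open>
The weights \<open>1 / (m+1)\<close> over the window \<open>[n, (1 + 1/q) n]\<close> add up to at least \<open>1 / (3 q)\<close>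
whatever \<open>n\<close> is. If \<open>s\<close> were at least \<open>\<kappa>\<close> on such windows arbitrarily far out, the series would
violate the Cauchy criterion.
\<close>
lemma eventually_small_in_window:
  fixes s :: "nat \<Rightarrow> real" and q :: nat
  assumes s: "\<And>n. 0 \<le> s n" and sum: "summable (\<lambda>n. s n / real (Suc n))"
    and \<kappa>: "0 < \<kappa>" and q: "0 < q"
  shows "\<forall>\<^sub>F n in sequentially. \<exists>m. n \<le> m \<and> q * m \<le> Suc q * n \<and> s m < \<kappa>"
proof -
  obtain N where N: "\<And>m n. m \<ge> N \<Longrightarrow> norm (\<Sum>i=m..<n. s i / real (Suc i)) < \<kappa> / (3 * real q)"
    using sum \<kappa> q unfolding summable_Cauchy by (metis divide_pos_pos mult_pos_pos of_nat_0_less_iff zero_less_numeral)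
  show ?thesis
  proof (rule eventually_sequentiallyI[of "max 1 N"])
    fix n assume n: "max 1 N \<le> n"
    show "\<exists>m. n \<le> m \<and> q * m \<le> Suc q * n \<and> s m < \<kappa>"
    proof (rule ccontr)
      assume neg: "\<nexists>m. n \<le> m \<and> q * m \<le> Suc q * n \<and> s m < \<kappa>"
      define r where "r = n div q"
      have rq: "q * r \<le> n" "n < q * Suc r"
        using q by (simp_all add: r_def dividend_less_times_div)
      have "r \<le> n" by (simp add: r_def)
      have ge: "\<kappa> / (3 * real n) \<le> s m / real (Suc m)" if m: "m \<in> {n..<Suc (n + r)}" for m
      proof -
        have "q * m \<le> q * (n + r)" using m by (intro mult_left_mono) auto
        also have "\<dots> \<le> Suc q * n" using rq by (simp add: algebra_simps)
        finally have "\<kappa> \<le> s m" using neg m by force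
        moreover have "Suc m \<le> 3 * n" using m n \<open>r \<le> n\<close> by auto
        then have "real (Suc m) \<le> 3 * real n" by linarith
        ultimately show ?thesis using \<kappa> by (intro frac_le) (auto simp del: of_nat_Suc)
      qed
      have "\<kappa> / (3 * real q) \<le> real (Suc r) * (\<kappa> / (3 * real n))"
      proof -
        have "real n \<le> real q * real (Suc r)" using rq(2) by (metis less_imp_le of_nat_le_iff of_nat_mult)
        then have "\<kappa> * real n \<le> \<kappa> * (real q * real (Suc r))" using \<kappa> by (intro mult_left_mono) auto
        then show ?thesis using n q by (simp add: field_simps del: of_nat_Suc)
      qed
      also have "\<dots> = (\<Sum>m\<in>{n..<Suc (n + r)}. \<kappa> / (3 * real n))"
        by (simp add: algebra_simps)
      also have "\<dots> \<le> (\<Sum>m\<in>{n..<Suc (n + r)}. s m / real (Suc m))"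
        using ge by (rule sum_mono)
      also have "\<dots> < \<kappa> / (3 * real q)"
        using N[of n "Suc (n + r)"] n by (simp del: of_nat_Suc)
      finally show False by simp
    qed
  qed
qed

text \<open>
In the window starting at \<open>n\<close> there is an \<open>m\<close> with \<open>a m \<le> (c + \<epsilon>/2) m\<close>, and
\<open>a n \<le> a m\<close>; the choice of \<open>q\<close> makes the loss of the factor \<open>m / n \<le> 1 + 1/q\<close> harmless. Only the
positive part enters, so that the lemma also applies when there is just a one-sided recursion.
\<close>
lemma eventually_upper_of_weighted_summable:
  fixes a :: "nat \<Rightarrow> real"
  assumes mono: "mono a" and c: "0 \<le> c"
    and sum: "summable (\<lambda>n. (max 0 (a n / real n - c))\<^sup>2 / real (Suc n))"
    and e: "0 < \<epsilon>"
  shows "\<forall>\<^sub>F n in sequentially. a n / real n < c + \<epsilon>"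
proof -
  obtain q :: nat where q: "(c + \<epsilon>) / (\<epsilon> / 2) < real q"
    using reals_Archimedean2 by blast
  then have qpos: "0 < q" using c e by (cases "q = 0") (auto simp: field_simps)
  have key: "(c + \<epsilon> / 2) * real (Suc q) < (c + \<epsilon>) * real q"
    using q e by (simp add: field_simps)
  have "\<forall>\<^sub>F n in sequentially. \<exists>m. n \<le> m \<and> q * m \<le> Suc q * n \<and> (max 0 (a m / real m - c))\<^sup>2 < (\<epsilon> / 2)\<^sup>2"
    using e qpos by (intro eventually_small_in_window sum) auto
  then show ?thesis using eventually_gt_at_top[of 0]
  proof eventually_elim
    case (elim n)
    then obtain m where m: "n \<le> m" "q * m \<le> Suc q * n" "(max 0 (a m / real m - c))\<^sup>2 < (\<epsilon> / 2)\<^sup>2" by auto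
    have "max 0 (a m / real m - c) < \<epsilon> / 2"
      using m(3) e by (meson half_gt_zero less_imp_le power2_less_imp_less)
    then have "a m / real m - c < \<epsilon> / 2" by (metis max_less_iff_conj)
    then have "a m / real m < c + \<epsilon> / 2" by linarith
    then have "a m < (c + \<epsilon> / 2) * real m" using m(1) elim by (simp add: pos_divide_less_eq)
    then have "a n < (c + \<epsilon> / 2) * real m" using monoD[OF mono m(1)] by linarith
    then have "a n * real q < (c + \<epsilon> / 2) * (real q * real m)" using qpos by (simp add: mult.assoc mult.commute)
    also have "\<dots> \<le> (c + \<epsilon> / 2) * (real (Suc q) * real n)"
      using m(2) c e by (intro mult_left_mono) (metis of_nat_le_iff of_nat_mult, auto)
    also have "\<dots> < (c + \<epsilon>) * real q * real n" using key elim by (simp add: mult.assoc[symmetric] del: of_nat_Suc)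
    finally have "a n < (c + \<epsilon>) * real n" using qpos
      by (metis mult.assoc mult.commute mult_less_cancel_right_pos of_nat_0_less_iff)
    then show ?case using elim by (simp add: field_simps)
  qed
qed

text \<open>
Mirror image of the upper bound: the window now has to end at \<open>n\<close>, so it starts at
\<open>h n\<close>, the integer part of \<open>n / (1 + 1/q)\<close>. Rounding costs one unit, which is absorbed for large \<open>n\<close>.
\<close>
lemma eventually_lower_of_weighted_summable:
  fixes a :: "nat \<Rightarrow> real"
  assumes mono: "mono a" and a: "\<And>n. 0 \<le> a n"
    and sum: "summable (\<lambda>n. (a n / real n - c)\<^sup>2 / real (Suc n))"
    and e: "0 < \<epsilon>"
  shows "\<forall>\<^sub>F n in sequentially. c - \<epsilon> < a n / real n"
proof (cases "c - \<epsilon> < 0")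
  case True
  then show ?thesis using a by (intro always_eventually allI) (meson divide_nonneg_nonneg of_nat_0_le_iff less_le_trans)
next
  case False
  obtain q :: nat where q: "2 * c / (\<epsilon> / 2) < real q"
    using reals_Archimedean2 by blast
  then have qpos: "0 < q" using False e by (cases "q = 0") (auto simp: field_simps)
  have key: "(c - \<epsilon>) * real (Suc q) < (c - \<epsilon> / 2) * real q"
    using q e False by (simp add: field_simps)
  define h where "h n = (q * n) div Suc q" for n
  have hlow: "q * n < Suc q * Suc (h n)" and hup: "Suc q * h n \<le> q * n" for n
    using dividend_less_times_div[of "Suc q" "q * n"] times_div_less_eq_dividend[of "Suc q" "q * n"]
    by (simp_all add: h_def)
  have hlim: "filterlim h at_top sequentially"
  proof (rule filterlim_at_top_mono)
    show "filterlim (\<lambda>n. n div 2) at_top sequentially"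
    proof (rule filterlim_at_top[THEN iffD2], rule allI)
      fix Z :: nat show "\<forall>\<^sub>F n in sequentially. Z \<le> n div 2"
        by (rule eventually_sequentiallyI[of "2 * Z"]) auto
    qed
    show "\<forall>\<^sub>F n in sequentially. n div 2 \<le> h n"
    proof (intro always_eventually allI)
      fix n
      have "Suc q * (n div 2) \<le> q * n"
      proof -
        have "Suc q * (n div 2) \<le> (q + q) * (n div 2)" using qpos by (intro mult_right_mono) auto
        also have "\<dots> = q * (2 * (n div 2))" by simp
        also have "\<dots> \<le> q * n" by (intro mult_left_mono) auto
        finally show ?thesis .
      qed
      then show "n div 2 \<le> h n" unfolding h_def by (metis mult.commute div_le_mono nonzero_mult_div_cancel_right old.nat.distinct(2))
    qed
  qed
  have w: "\<forall>\<^sub>F n in sequentially. \<exists>m. h n \<le> m \<and> q * m \<le> Suc q * h n \<and> (a m / real m - c)\<^sup>2 < (\<epsilon> / 2)\<^sup>2"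
    using eventually_small_in_window[of "\<lambda>m. (a m / real m - c)\<^sup>2" "(\<epsilon> / 2)\<^sup>2" q] sum e qpos
    by (intro eventually_compose_filterlim[OF _ hlim]) auto
  obtain N where N: "(c - \<epsilon> / 2) * real (Suc q) / ((c - \<epsilon> / 2) * real q - (c - \<epsilon>) * real (Suc q)) < real N"
    using reals_Archimedean2 by blast
  have h1: "\<forall>\<^sub>F n in sequentially. 1 \<le> h n" using hlim by (simp add: filterlim_at_top)
  from w h1 eventually_ge_at_top[of "max 1 N"] show ?thesis
  proof eventually_elim
    case (elim n)
    then obtain m where m: "h n \<le> m" "q * m \<le> Suc q * h n" "(a m / real m - c)\<^sup>2 < (\<epsilon> / 2)\<^sup>2" by auto
    have mpos: "0 < m" using m elim by linarith
    have "\<bar>a m / real m - c\<bar> < \<epsilon> / 2" using m(3) e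
      by (metis abs_ge_zero half_gt_zero less_imp_le power2_abs power2_less_imp_less)
    then have "c - \<epsilon> / 2 < a m / real m" by linarith
    then have am: "(c - \<epsilon> / 2) * real m < a m" using mpos by (simp add: pos_less_divide_eq)
    have "q * m \<le> q * n" using m(2) hup[of n] by linarith
    then have "m \<le> n" using qpos by simp
    have "q * n \<le> Suc q * Suc m" using hlow[of n] m(1) by (meson Suc_le_mono less_imp_le mult_le_mono2 order_trans)
    then have "real q * real n \<le> real (Suc q) * real (Suc m)" by (metis of_nat_le_iff of_nat_mult)
    then have qn: "real q * real n \<le> real (Suc q) * real m + real (Suc q)" by (simp add: algebra_simps)
    have ce: "0 \<le> c - \<epsilon> / 2" using False e by linarith
    have "(c - \<epsilon>) * real (Suc q) * real n < (c - \<epsilon> / 2) * real q * real n - (c - \<epsilon> / 2) * real (Suc q)"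
    proof -
      have "(c - \<epsilon> / 2) * real (Suc q) < real N * ((c - \<epsilon> / 2) * real q - (c - \<epsilon>) * real (Suc q))"
        using N key by (subst (asm) pos_divide_less_eq) (auto simp del: of_nat_Suc)
      also have "\<dots> \<le> real n * ((c - \<epsilon> / 2) * real q - (c - \<epsilon>) * real (Suc q))"
        using elim key by (intro mult_right_mono) (auto simp del: of_nat_Suc)
      finally show ?thesis by (simp add: algebra_simps)
    qed
    also have "\<dots> \<le> (c - \<epsilon> / 2) * (real (Suc q) * real m)"
      using mult_left_mono[OF qn ce] by (simp only: distrib_left mult.assoc diff_le_eq)
    also have "\<dots> < real (Suc q) * a m" using am by (simp add: mult.left_commute del: of_nat_Suc)
    also have "\<dots> \<le> real (Suc q) * a n" using monoD[OF mono \<open>m \<le> n\<close>] by (intro mult_left_mono) auto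
    finally have "(c - \<epsilon>) * real n < a n"
      by (metis mult.assoc mult.commute mult_less_cancel_left_pos of_nat_0_less_iff zero_less_Suc)
    then show ?case using elim by (simp add: field_simps)
  qed
qed

text \<open>
Convexity of the square. In the recursions below, \<open>s\<close> is \<open>n + 1\<close>, and the coefficients \<open>\<alpha>\<close> and
\<open>\<beta>\<close> add up to \<open>n\<close> or to \<open>n + 1\<close>.
\<close>
lemma weighted_square_le:
  fixes x y :: real
  assumes "0 \<le> \<alpha>" "0 \<le> \<beta>" "\<alpha> + \<beta> \<le> s"
  shows "(\<alpha> * x + \<beta> * y)\<^sup>2 \<le> s * (\<alpha> * x\<^sup>2 + \<beta> * y\<^sup>2)"
proof -
  have "(\<alpha> + \<beta>) * (\<alpha> * x\<^sup>2 + \<beta> * y\<^sup>2) - (\<alpha> * x + \<beta> * y)\<^sup>2 = \<alpha> * \<beta> * (x - y)\<^sup>2"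
    by (simp add: power2_eq_square algebra_simps)
  then have "(\<alpha> * x + \<beta> * y)\<^sup>2 \<le> (\<alpha> + \<beta>) * (\<alpha> * x\<^sup>2 + \<beta> * y\<^sup>2)"
    using assms(1,2) by (smt (verit) mult_nonneg_nonneg zero_le_power2)
  also have "\<dots> \<le> s * (\<alpha> * x\<^sup>2 + \<beta> * y\<^sup>2)"
    using assms by (intro mult_right_mono) auto
  finally show ?thesis .
qed

lemma summable_divide_Suc_square: "summable (\<lambda>n. C / (real (Suc n))\<^sup>2)"
proof -
  have "summable (\<lambda>n. inverse ((real (Suc n))\<^sup>2))"
    using inverse_power_summable[of 2, where 'a = real] by (subst summable_Suc_iff) simp
  then have "summable (\<lambda>n. C * inverse ((real (Suc n))\<^sup>2))" by (rule summable_mult)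
  then show ?thesis by (simp add: divide_inverse)
qed

text \<open>
Half of the terms before \<open>n\<close>, those from \<open>n div 2\<close> on, are each at least \<open>t n\<close>, and their sum is a
Cauchy tail.
\<close>
lemma decreasing_summable_imp_mult_tendsto_0:
  fixes t :: "nat \<Rightarrow> real"
  assumes "antimono t" and t: "\<And>n. 0 \<le> t n" and sum: "summable t"
  shows "(\<lambda>n. real n * t n) \<longlonglongrightarrow> 0"
proof (rule LIMSEQ_I)
  fix r :: real assume r: "0 < r"
  obtain N where N: "\<And>m n. m \<ge> N \<Longrightarrow> norm (\<Sum>i=m..<n. t i) < r / 2"
    using sum r unfolding summable_Cauchy by (metis half_gt_zero)
  show "\<exists>no. \<forall>n\<ge>no. norm (real n * t n - 0) < r"
  proof (intro exI allI impI)
    fix n assume n: "2 * N \<le> n"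
    have "real n / 2 * t n \<le> real (n - n div 2) * t n"
      by (intro mult_right_mono t) linarith
    also have "\<dots> = (\<Sum>i=n div 2..<n. t n)" by simp
    also have "\<dots> \<le> (\<Sum>i=n div 2..<n. t i)"
      by (intro sum_mono antimonoD[OF assms(1)]) auto
    also have "\<dots> \<le> norm (\<Sum>i=n div 2..<n. t i)" by simp
    also have "\<dots> < r / 2" using n by (intro N) linarith
    finally show "norm (real n * t n - 0) < r" using t[of n] by simp
  qed
qed

text \<open>
Scheffe's lemma for counting measure: for probability weights, pointwise convergence implies
convergence in total variation, because no mass can escape.
\<close>
lemma tv_norm_tendsto_0_Scheffe:
  fixes a :: "nat \<Rightarrow> nat \<Rightarrow> real" and b :: "nat \<Rightarrow> real"
  assumes a0: "\<And>n k. 0 \<le> a n k" and b0: "\<And>k. 0 \<le> b k"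
    and a: "\<And>n. a n sums 1" and b: "b sums 1"
    and lim: "\<And>k. (\<lambda>n. a n k) \<longlonglongrightarrow> b k"
  shows "(\<lambda>n. tv_norm (\<lambda>k. a n k - b k)) \<longlonglongrightarrow> 0"
proof -
  have norm1: "(\<integral>\<^sup>+k. ennreal (norm (c k)) \<partial>count_space UNIV) = 1" if "\<And>k. 0 \<le> c k" "c sums 1" for c :: "nat \<Rightarrow> real"
    using that by (simp add: nn_integral_count_space_nat suminf_ennreal_eq sums_iff)
  have "(\<lambda>n. \<integral>\<^sup>+k. norm (a n k - b k) \<partial>count_space UNIV) \<longlonglongrightarrow> 0"
  proof (rule Scheffe_lemma2)
    show "integrable (count_space UNIV) b"
      by (rule integrableI_bounded) (use norm1[OF b0 b] in auto)
    show "AE k in count_space UNIV. (\<lambda>n. a n k) \<longlonglongrightarrow> b k" using lim by simp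
    fix n show "(\<integral>\<^sup>+k. norm (a n k) \<partial>count_space UNIV) \<le> (\<integral>\<^sup>+k. norm (b k) \<partial>count_space UNIV)"
      using norm1[OF b0 b] norm1[OF a0 a, of n] by simp
  qed simp
  then show ?thesis by (simp add: tv_norm_def nn_integral_count_space_nat)
qed

section \<open>Sums of independent indicators and Poisson weights\<close>

definition poisson_weight :: "real \<Rightarrow> nat \<Rightarrow> real" where
  "poisson_weight x k = x ^ k / fact k * exp (- x)"

text \<open>
Convolution with the unit mass at 1. It appears both as the effect of a successful trial on the
weights of a sum and as a part of the derivative of the Poisson weights in their parameter.
\<close>
definition shift_right :: "(nat \<Rightarrow> real) \<Rightarrow> nat \<Rightarrow> real" where
  "shift_right a k = (case k of 0 \<Rightarrow> 0 | Suc j \<Rightarrow> a j)"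

lemma shift_right_simps [simp]: "shift_right a 0 = 0" "shift_right a (Suc j) = a j"
  by (simp_all add: shift_right_def)

lemma shift_right_bounds:
  assumes "\<And>k. lo \<le> a k" "\<And>k. a k \<le> hi" "lo \<le> 0" "0 \<le> hi"
  shows "lo \<le> shift_right a k" "shift_right a k \<le> hi"
  using assms by (cases k; simp)+

lemma poisson_weight_bounds:
  assumes "0 \<le> x" shows "0 \<le> poisson_weight x k" "poisson_weight x k \<le> 1"
proof -
  show "0 \<le> poisson_weight x k" using assms by (simp add: poisson_weight_def)
  have "x ^ k / fact k = (\<Sum>i\<in>{k}. x ^ i / fact i)" by simp
  also have "\<dots> \<le> (\<Sum>i. x ^ i / fact i)"
    using assms summable_exp[of x]
    by (intro sum_le_suminf) (auto simp: divide_inverse mult.commute)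
  also have "\<dots> = exp x" by (simp add: exp_def divide_inverse mult.commute)
  finally show "poisson_weight x k \<le> 1"
    by (simp add: poisson_weight_def exp_minus field_simps)
qed

lemma DERIV_poisson_weight:
  "((\<lambda>x. poisson_weight x k) has_real_derivative
      shift_right (poisson_weight x) k - poisson_weight x k) (at x)"
proof (cases k)
  case 0
  then show ?thesis unfolding poisson_weight_def
    by (auto intro!: derivative_eq_intros)
next
  case (Suc j)
  have "((\<lambda>x. x ^ Suc j / fact (Suc j) * exp (- x)) has_real_derivative
      (real (Suc j) * x ^ j / fact (Suc j)) * exp (- x) - x ^ Suc j / fact (Suc j) * exp (- x)) (at x)"
    by (rule derivative_eq_intros refl | simp)+
  moreover have "real (Suc j) * x ^ j / fact (Suc j) = x ^ j / fact j"
    by (subst fact_Suc) (simp del: of_nat_Suc)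
  ultimately show ?thesis by (simp only: Suc poisson_weight_def shift_right_simps)
qed

text \<open>
Adding a Bernoulli variable with parameter \<open>p\<close> agrees to first order in \<open>p\<close> with raising the
Poisson parameter by \<open>p\<close>, because the derivative of the weights in the parameter is shift minus
identity. The second derivative applies shift minus identity twice, hence is bounded by
\<open>1 + 2 + 1 = 4\<close>, and Taylor's formula gives the error \<open>4 / 2 * p\<^sup>2\<close>.
\<close>
lemma poisson_weight_add_one_Bernoulli:
  assumes x: "0 \<le> x" and p: "0 \<le> p"
  shows "\<bar>poisson_weight (x + p) k - ((1 - p) * poisson_weight x k + p * shift_right (poisson_weight x) k)\<bar> \<le> 2 * p\<^sup>2"
proof (cases "p = 0")
  case False
  define g where "g m y = (case m of 0 \<Rightarrow> poisson_weight y k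
     | Suc 0 \<Rightarrow> shift_right (poisson_weight y) k - poisson_weight y k
     | _ \<Rightarrow> shift_right (shift_right (poisson_weight y)) k - 2 * shift_right (poisson_weight y) k
           + poisson_weight y k)" for m :: nat and y
  have g01: "g 0 = (\<lambda>y. poisson_weight y k)"
    "g (Suc 0) = (\<lambda>y. shift_right (poisson_weight y) k - poisson_weight y k)"
    by (simp_all add: g_def fun_eq_iff)
  \<comment> \<open>The functions \<open>g 0\<close>, \<open>g 1\<close>, \<open>g 2\<close> are the weight at \<open>k\<close> and its first two derivatives in the parameter.\<close>
  have d1: "((\<lambda>y. shift_right (poisson_weight y) k) has_real_derivative
      shift_right (shift_right (poisson_weight y)) k - shift_right (poisson_weight y) k) (at y)" for y
    by (cases k) (auto intro: DERIV_poisson_weight)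
  have der: "\<forall>m t. m < 2 \<and> x \<le> t \<and> t \<le> x + p \<longrightarrow> DERIV (g m) t :> g (Suc m) t"
  proof (intro allI impI)
    fix m :: nat and t assume "m < 2 \<and> x \<le> t \<and> t \<le> x + p"
    then consider "m = 0" | "m = 1" by linarith
    then show "DERIV (g m) t :> g (Suc m) t"
    proof cases
      case 1 then show ?thesis by (simp add: g01 DERIV_poisson_weight)
    next
      case 2
      have "DERIV (\<lambda>y. shift_right (poisson_weight y) k - poisson_weight y k) t :>
         (shift_right (shift_right (poisson_weight t)) k - shift_right (poisson_weight t) k)
         - (shift_right (poisson_weight t) k - poisson_weight t k)"
        by (intro DERIV_diff d1 DERIV_poisson_weight)
      moreover have "g (Suc m) t = (shift_right (shift_right (poisson_weight t)) k - shift_right (poisson_weight t) k)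
         - (shift_right (poisson_weight t) k - poisson_weight t k)"
        by (simp add: 2 g_def)
      ultimately show ?thesis by (simp add: 2 g01)
    qed
  qed
  have "\<exists>t>x. t < x + p \<and> poisson_weight (x + p) k
      = (\<Sum>m<2. g m x / fact m * ((x + p) - x) ^ m) + g 2 t / fact 2 * ((x + p) - x)\<^sup>2"
    by (rule Taylor_up[OF _ _ der]) (use p False in \<open>auto simp: g_def\<close>)
  then obtain t where t: "x < t" and eq: "poisson_weight (x + p) k
      = g 0 x + g 1 x * p + g 2 t / 2 * p\<^sup>2"
    by (auto simp: numeral_2_eq_2)
  have t0: "0 \<le> t" using t x by simp
  note b = poisson_weight_bounds[OF t0]
  note b1 = shift_right_bounds[of 0 "poisson_weight t" 1, OF b(1) b(2), simplified]
  note b2 = shift_right_bounds[of 0 "shift_right (poisson_weight t)" 1, OF b1(1) b1(2), simplified]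
  have "\<bar>g 2 t\<bar> \<le> 4"
    using b[of k] b1[of k] b2[of k] by (simp add: g_def numeral_2_eq_2 abs_le_iff)
  then have "\<bar>g 2 t / 2 * p\<^sup>2\<bar> \<le> 2 * p\<^sup>2"
    by (simp add: abs_mult mult_right_mono)
  moreover have "g 0 x + g 1 x * p = (1 - p) * poisson_weight x k + p * shift_right (poisson_weight x) k"
    by (simp add: g_def algebra_simps)
  ultimately show ?thesis using eq by simp
qed simp

lemma sum_indicator_eq_card_Collect:
  "finite J \<Longrightarrow> (\<Sum>j\<in>J. indicator (A j) \<omega>) = real (card {j\<in>J. \<omega> \<in> A j})"
proof (induction J rule: finite_induct)
  case (insert i J)
  have "{j \<in> insert i J. \<omega> \<in> A j} = (if \<omega> \<in> A i then insert i {j\<in>J. \<omega> \<in> A j} else {j\<in>J. \<omega> \<in> A j})" by auto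
  then show ?case using insert by simp
qed simp

lemma sets_Collect_card:
  assumes "finite J" "\<And>j. j \<in> J \<Longrightarrow> A j \<in> sets M"
  shows "{\<omega>\<in>space M. card {j\<in>J. \<omega> \<in> A j} = k} \<in> sets M"
proof -
  have "{\<omega>\<in>space M. (\<Sum>j\<in>J. indicator (A j) \<omega>) = real k} \<in> sets M"
    using assms by measurable
  then show ?thesis by (simp only: sum_indicator_eq_card_Collect[OF assms(1)] of_nat_eq_iff)
qed

context prob_space
begin

text \<open>
The new event \<open>A i\<close> either fails, and the count is unchanged, or occurs, and the count goes up by
one. The event \<open>C\<close> is a slot for further events, to be filled in an induction over \<open>J\<close>.
\<close>
lemma prob_Int_card_insert:
  assumes J: "finite J" "i \<notin> J" and A: "\<And>j. j \<in> insert i J \<Longrightarrow> A j \<in> events" and C: "C \<in> events"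
  shows "prob (C \<inter> {\<omega>\<in>space M. card {j\<in>insert i J. \<omega> \<in> A j} = k})
    = prob (C \<inter> {\<omega>\<in>space M. card {j\<in>J. \<omega> \<in> A j} = k})
      - prob ((C \<inter> A i) \<inter> {\<omega>\<in>space M. card {j\<in>J. \<omega> \<in> A j} = k})
      + shift_right (\<lambda>k. prob ((C \<inter> A i) \<inter> {\<omega>\<in>space M. card {j\<in>J. \<omega> \<in> A j} = k})) k"
proof -
  define N where "N k = {\<omega>\<in>space M. card {j\<in>J. \<omega> \<in> A j} = k}" for k
  have N: "N k \<in> events" for k
    unfolding N_def using J A by (intro sets_Collect_card) auto
  define F where "F = (case k of 0 \<Rightarrow> {} | Suc k' \<Rightarrow> (C \<inter> A i) \<inter> N k')"
  have F: "F \<in> events" using A C N by (cases k) (auto simp: F_def)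
  have cardi: "card {j \<in> insert i J. \<omega> \<in> A j} = (if \<omega> \<in> A i then Suc (card {j\<in>J. \<omega> \<in> A j}) else card {j\<in>J. \<omega> \<in> A j})" for \<omega>
  proof -
    have "{j \<in> insert i J. \<omega> \<in> A j} = (if \<omega> \<in> A i then insert i {j\<in>J. \<omega> \<in> A j} else {j\<in>J. \<omega> \<in> A j})" by auto
    then show ?thesis using J by simp
  qed
  have "C \<inter> {\<omega>\<in>space M. card {j\<in>insert i J. \<omega> \<in> A j} = k} = (C \<inter> N k - (C \<inter> A i) \<inter> N k) \<union> F"
    by (cases k) (auto simp only: N_def F_def cardi split: if_splits nat.splits)
  moreover have "(C \<inter> N k - (C \<inter> A i) \<inter> N k) \<inter> F = {}"
    by (cases k) (auto simp: N_def F_def)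
  ultimately have "prob (C \<inter> {\<omega>\<in>space M. card {j\<in>insert i J. \<omega> \<in> A j} = k})
      = prob (C \<inter> N k - (C \<inter> A i) \<inter> N k) + prob F"
    using A C N F by (simp add: finite_measure_Union)
  also have "prob (C \<inter> N k - (C \<inter> A i) \<inter> N k) = prob (C \<inter> N k) - prob ((C \<inter> A i) \<inter> N k)"
    using A C N by (intro finite_measure_Diff) auto
  also have "prob F = shift_right (\<lambda>k. prob ((C \<inter> A i) \<inter> N k)) k"
    by (cases k) (simp_all add: F_def)
  finally show ?thesis by (simp add: N_def)
qed

text \<open>
The number of events that occur in one group is independent of the joint occurrence of the
events in a disjoint group. The conjunction over \<open>B\<close> is kept general because the induction over
\<open>J\<close> moves elements from \<open>J\<close> to \<open>B\<close>.
\<close>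
lemma indep_events_Int_card:
  assumes ind: "indep_events A I" and J: "finite J" "J \<subseteq> I"
    and B: "finite B" "B \<subseteq> I" "B \<inter> J = {}"
  shows "prob (({\<omega>\<in>space M. \<forall>i\<in>B. \<omega> \<in> A i}) \<inter> {\<omega>\<in>space M. card {j\<in>J. \<omega> \<in> A j} = k})
    = (\<Prod>i\<in>B. prob (A i)) * prob {\<omega>\<in>space M. card {j\<in>J. \<omega> \<in> A j} = k}"
proof -
  have ev: "A i \<in> events" if "i \<in> I" for i using ind that by (auto simp: indep_events_def)
  define C where "C B = {\<omega>\<in>space M. \<forall>i\<in>B. \<omega> \<in> A i}" for B
  define N where "N J k = {\<omega>\<in>space M. card {j\<in>J. \<omega> \<in> A j} = k}" for J k
  have C: "C B \<in> events" if "finite B" "B \<subseteq> I" for B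
    unfolding C_def using that ev
    by (intro sets.sets_Collect_finite_All)
      (auto simp: Int_def[symmetric] Int_absorb1 sets.sets_into_space)
  have CA: "C B \<inter> A i = C (insert i B)" if "i \<in> I" for B i
    using ev[OF that] sets.sets_into_space by (auto simp: C_def)
  have CN: "C {} \<inter> N J k = N J k" for J k by (auto simp: C_def N_def)
  have "prob (C B \<inter> N J k) = (\<Prod>i\<in>B. prob (A i)) * prob (N J k)"
    using J B
  proof (induction J arbitrary: B k rule: finite_induct)
    case empty
    have N0: "N {} k = (if k = 0 then space M else {})" by (simp add: N_def)
    have CB: "C B \<inter> space M = (if B = {} then space M else (\<Inter>i\<in>B. A i))"
    proof (cases "B = {}")
      case False
      then obtain b where b: "b \<in> B" by auto
      then have "A b \<subseteq> space M" using ev empty.prems by (intro sets.sets_into_space) auto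
      then show ?thesis using b by (auto simp: C_def)
    qed (simp add: C_def)
    show ?case
      using ind empty.prems by (simp add: N0 CB indep_events_def prob_space)
  next
    case (insert i J)
    have i: "i \<in> I" "J \<subseteq> I" using insert.prems by auto
    have step: "prob (C B \<inter> N (insert i J) k) = (\<Prod>i\<in>B. prob (A i)) *
        (prob (N J k) - prob (A i) * prob (N J k) + prob (A i) * shift_right (\<lambda>k. prob (N J k)) k)"
      if B: "finite B" "B \<subseteq> I" "B \<inter> insert i J = {}" for B k
    proof -
      have iB: "i \<notin> B" using B by auto
      have A: "A j \<in> events" if "j \<in> insert i J" for j using that i ev by auto
      have 1: "prob (C B \<inter> N J k) = (\<Prod>i\<in>B. prob (A i)) * prob (N J k)" for k
        using B i by (intro insert.IH) auto
      have 2: "prob (C (insert i B) \<inter> N J k) = (\<Prod>i\<in>B. prob (A i)) * prob (A i) * prob (N J k)" for k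
        using insert.IH[of "insert i B" k] B i iB insert.hyps by (simp add: mult.commute)
      have "prob (C B \<inter> N (insert i J) k) = prob (C B \<inter> N J k) - prob ((C B \<inter> A i) \<inter> N J k)
          + shift_right (\<lambda>k. prob ((C B \<inter> A i) \<inter> N J k)) k"
        unfolding N_def using insert.hyps A C[OF B(1,2)] by (rule prob_Int_card_insert)
      then have eq: "prob (C B \<inter> N (insert i J) k) = (\<Prod>i\<in>B. prob (A i)) * prob (N J k)
          - (\<Prod>i\<in>B. prob (A i)) * prob (A i) * prob (N J k)
          + shift_right (\<lambda>k. (\<Prod>i\<in>B. prob (A i)) * prob (A i) * prob (N J k)) k"
        by (simp only: CA[OF i(1)] 1 2)
      show ?thesis unfolding eq
        by (cases k) (simp_all add: algebra_simps)
    qed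
    show ?case using step[of B k] step[of "{}" k] insert.prems by (simp add: CN)
  qed
  then show ?thesis by (simp add: C_def N_def)
qed

lemma prob_card_insert:
  assumes ind: "indep_events A I" and J: "finite J" "J \<subseteq> I" and i: "i \<in> I" "i \<notin> J"
  shows "prob {\<omega>\<in>space M. card {j\<in>insert i J. \<omega> \<in> A j} = k}
    = (1 - prob (A i)) * prob {\<omega>\<in>space M. card {j\<in>J. \<omega> \<in> A j} = k}
      + prob (A i) * shift_right (\<lambda>k. prob {\<omega>\<in>space M. card {j\<in>J. \<omega> \<in> A j} = k}) k"
proof -
  have ev: "A i \<in> events" if "i \<in> I" for i using ind that by (auto simp: indep_events_def)
  have N: "space M \<inter> {\<omega>\<in>space M. P \<omega>} = {\<omega>\<in>space M. P \<omega>}" for P by auto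
  have Ai: "space M \<inter> A i = {\<omega>\<in>space M. \<forall>j\<in>{i}. \<omega> \<in> A j}" by auto
  have A: "A j \<in> events" if "j \<in> insert i J" for j using that i J ev by auto
  define q where "q k = prob {\<omega>\<in>space M. card {j\<in>J. \<omega> \<in> A j} = k}" for k
  have AN: "prob ((space M \<inter> A i) \<inter> {\<omega>\<in>space M. card {j\<in>J. \<omega> \<in> A j} = k}) = prob (A i) * q k" for k
    unfolding Ai q_def using indep_events_Int_card[OF ind J, of "{i}" k] i by simp
  have "prob {\<omega>\<in>space M. card {j\<in>insert i J. \<omega> \<in> A j} = k}
    = q k - prob (A i) * q k + shift_right (\<lambda>k. prob (A i) * q k) k"
    using prob_Int_card_insert[where A = A and k = k, OF J(1) i(2) A sets.top]
    unfolding AN unfolding N q_def by simp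
  also have "\<dots> = (1 - prob (A i)) * q k + prob (A i) * shift_right q k"
    by (cases k) (simp_all add: algebra_simps)
  finally show ?thesis by (simp only: q_def[abs_def])
qed

text \<open>
Le Cam's Poisson approximation in the supremum norm. A Bernoulli step is a convex combination
of the identity and a shift, so it does not enlarge the error made so far; each step then adds at
most \<open>2 * p\<^sup>2\<close>.
\<close>
lemma le_Cam_pointwise:
  assumes ind: "indep_events A I" and J: "finite J" "J \<subseteq> I"
  shows "\<bar>prob {\<omega>\<in>space M. card {j\<in>J. \<omega> \<in> A j} = k} - poisson_weight (\<Sum>j\<in>J. prob (A j)) k\<bar>
      \<le> 2 * (\<Sum>j\<in>J. (prob (A j))\<^sup>2)"
  using J
proof (induction J arbitrary: k rule: finite_induct)
  case empty
  then show ?case by (cases k) (simp_all add: poisson_weight_def prob_space)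
next
  case (insert i J)
  define q where "q k = prob {\<omega>\<in>space M. card {j\<in>J. \<omega> \<in> A j} = k}" for k
  define x where "x = (\<Sum>j\<in>J. prob (A j))"
  define p where "p = prob (A i)"
  define e where "e = 2 * (\<Sum>j\<in>J. (prob (A j))\<^sup>2)"
  have IH: "\<bar>q k - poisson_weight x k\<bar> \<le> e" for k
    using insert.IH insert.prems by (simp add: q_def x_def e_def)
  have e0: "0 \<le> e" using IH[of 0] by linarith
  have IHs: "\<bar>shift_right q k - shift_right (poisson_weight x) k\<bar> \<le> e"
    using IH e0 by (cases k) auto
  have p: "0 \<le> p" "p \<le> 1" by (simp_all add: p_def)
  have x: "0 \<le> x" by (simp add: x_def sum_nonneg)
  have "prob {\<omega>\<in>space M. card {j\<in>insert i J. \<omega> \<in> A j} = k} = (1 - p) * q k + p * shift_right q k"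
    using prob_card_insert[OF ind, of J i k] insert by (simp add: p_def q_def[abs_def])
  moreover have "\<bar>((1 - p) * q k + p * shift_right q k)
      - ((1 - p) * poisson_weight x k + p * shift_right (poisson_weight x) k)\<bar> \<le> e"
  proof -
    have "((1 - p) * q k + p * shift_right q k)
      - ((1 - p) * poisson_weight x k + p * shift_right (poisson_weight x) k)
      = (1 - p) * (q k - poisson_weight x k) + p * (shift_right q k - shift_right (poisson_weight x) k)"
      by (simp add: algebra_simps)
    also have "\<bar>\<dots>\<bar> \<le> (1 - p) * e + p * e"
      using p IH[of k] IHs
      by (intro order_trans[OF abs_triangle_ineq] add_mono) (simp_all add: abs_mult mult_left_mono)
    finally show ?thesis by (simp add: algebra_simps)
  qed
  moreover have "\<bar>poisson_weight (x + p) k - ((1 - p) * poisson_weight x k + p * shift_right (poisson_weight x) k)\<bar> \<le> 2 * p\<^sup>2"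
    by (rule poisson_weight_add_one_Bernoulli[OF x p(1)])
  ultimately have "\<bar>prob {\<omega>\<in>space M. card {j\<in>insert i J. \<omega> \<in> A j} = k} - poisson_weight (x + p) k\<bar> \<le> e + 2 * p\<^sup>2"
    by linarith
  then show ?case using insert.hyps
    by (simp add: x_def p_def e_def algebra_simps)
qed

text \<open>
The centred count has mean 0 and variance at most \<open>b\<close>, so adding it to a constant \<open>y\<close> costs at most
\<open>b\<close> in the second moment.
\<close>
lemma integral_centered_card_square:
  assumes ind: "indep_events A I" and J: "finite J" "J \<subseteq> I"
  defines "b \<equiv> \<Sum>j\<in>J. prob (A j)"
  shows "(\<integral>\<omega>. (y + real (card {j\<in>J. \<omega> \<in> A j}) - b)\<^sup>2 \<partial>M) \<le> y\<^sup>2 + b"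
proof -
  define p where "p j = prob (A j)" for j
  have ev[measurable]: "A i \<in> events" if "i \<in> J" for i using ind that J by (auto simp: indep_events_def)
  have int: "integrable M (indicator (A i) :: _ \<Rightarrow> real)" if "i \<in> J" for i
    using ev[OF that] by (simp add: integrable_real_indicator less_top[symmetric])
  have AA: "(\<integral>\<omega>. indicator (A i) \<omega> * indicator (A j) \<omega> \<partial>M) = prob (A i \<inter> A j)"
    if "i \<in> J" "j \<in> J" for i j
  proof -
    have "A i \<inter> A j \<in> events" using ev that by auto
    then show ?thesis by (subst indicator_inter_arith[symmetric]) (simp add: sets.Int_space_eq2)
  qed
  have pair: "(\<integral>\<omega>. indicator (A i) \<omega> * indicator (A j) \<omega> \<partial>M) \<le> p i * p j + (if i = j then p i else (0::real))"
    if ij: "i \<in> J" "j \<in> J" for i j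
  proof (cases "i = j")
    case True
    then show ?thesis using AA[OF ij] by (simp add: p_def)
  next
    case False
    have "\<forall>K\<subseteq>I. K \<noteq> {} \<longrightarrow> finite K \<longrightarrow> prob (\<Inter>l\<in>K. A l) = (\<Prod>l\<in>K. prob (A l))"
      using ind by (simp add: indep_events_def)
    from spec[OF this, of "{i, j}"] have "prob (\<Inter>l\<in>{i, j}. A l) = (\<Prod>l\<in>{i, j}. prob (A l))"
      using ij J(2) by auto
    then show ?thesis using False AA[OF ij] by (simp add: p_def)
  qed
  have intp: "integrable M (\<lambda>\<omega>. indicator (A i) \<omega> * indicator (A j) \<omega> :: real)" if "i \<in> J" "j \<in> J" for i j
  proof -
    have "A i \<inter> A j \<in> events" using ev that by auto
    then show ?thesis by (subst indicator_inter_arith[symmetric]) (simp add: integrable_real_indicator less_top[symmetric])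
  qed
  have "(\<integral>\<omega>. (y + real (card {j\<in>J. \<omega> \<in> A j}) - b)\<^sup>2 \<partial>M)
      = (\<integral>\<omega>. (y - b)\<^sup>2 + 2 * (y - b) * (\<Sum>i\<in>J. indicator (A i) \<omega>)
          + (\<Sum>i\<in>J. \<Sum>j\<in>J. indicator (A i) \<omega> * indicator (A j) \<omega>) \<partial>M)"
    by (intro Bochner_Integration.integral_cong refl)
      (simp add: sum_indicator_eq_card_Collect[OF J(1), symmetric] sum_product[symmetric] power2_eq_square algebra_simps)
  also have "\<dots> = (y - b)\<^sup>2 + 2 * (y - b) * (\<Sum>i\<in>J. p i)
          + (\<Sum>i\<in>J. \<Sum>j\<in>J. (\<integral>\<omega>. indicator (A i) \<omega> * indicator (A j) \<omega> \<partial>M))"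
    using int intp ev by (simp add: prob_space p_def sets.Int_space_eq2)
  also have "\<dots> \<le> (y - b)\<^sup>2 + 2 * (y - b) * (\<Sum>i\<in>J. p i)
          + (\<Sum>i\<in>J. \<Sum>j\<in>J. p i * p j + (if i = j then p i else 0))"
    by (intro add_left_mono sum_mono pair)
  also have "\<dots> = (y - b)\<^sup>2 + 2 * (y - b) * b + (b * b + b)"
    using J(1) by (simp add: sum.distrib b_def p_def sum_product)
  also have "\<dots> = y\<^sup>2 + b" by (simp add: power2_eq_square algebra_simps)
  finally show ?thesis .
qed

end

section \<open>The limiting weights\<close>

text \<open>
The tails of the limiting weights: \<open>tail_weight f k\<close> is the limiting proportion of vertices of
indegree at least \<open>k\<close>.
\<close>
definition tail_weight :: "(nat \<Rightarrow> real) \<Rightarrow> nat \<Rightarrow> real" where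
  "tail_weight f k = (\<Prod>l<k. f l / (1 + f l))"

context
  fixes f :: "nat \<Rightarrow> real"
  assumes rule: "attachment_rule f"
begin

lemma f_pos: "0 < f k" and f_le: "f k \<le> real k + 1" and f_mono: "i \<le> j \<Longrightarrow> f i \<le> f j"
  using rule by (auto simp: attachment_rule_def mono_def)

lemma tail_weight_0: "tail_weight f 0 = 1" by (simp add: tail_weight_def)

lemma tail_weight_pos: "0 < tail_weight f k"
  unfolding tail_weight_def by (intro prod_pos) (auto intro!: divide_pos_pos add_pos_pos f_pos)

text \<open>
The balance equation: at equilibrium the gain of vertices with indegree above \<open>k\<close>, at rate \<open>f k\<close> from
level \<open>k\<close>, compensates the dilution by new vertices.
\<close>
lemma tail_weight_Suc: "(1 + f k) * tail_weight f (Suc k) = f k * tail_weight f k"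
  using f_pos[of k] by (simp add: tail_weight_def)

lemma limit_weight_eq_diff: "limit_weight f k = tail_weight f k - tail_weight f (Suc k)"
  using f_pos[of k] unfolding limit_weight_def tail_weight_def
  by (simp add: field_simps)

lemma limit_weight_times_f: "limit_weight f k * f k = tail_weight f (Suc k)"
  using tail_weight_Suc[of k] by (simp add: limit_weight_eq_diff algebra_simps)

lemma limit_weight_pos: "0 < limit_weight f k"
  unfolding limit_weight_def using tail_weight_pos[of k, unfolded tail_weight_def]
  by (intro mult_pos_pos) (auto intro!: divide_pos_pos add_pos_pos f_pos)

lemma tail_weight_antimono: "antimono (tail_weight f)"
  using limit_weight_pos by (intro decseq_SucI) (simp add: limit_weight_eq_diff less_imp_le)

lemma tail_weight_le_1: "tail_weight f k \<le> 1"
  using antimonoD[OF tail_weight_antimono, of 0 k] by (simp add: tail_weight_0)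

lemma tail_weight_le_inverse: "tail_weight f k \<le> 1 / (real k + 1)"
proof (induction k)
  case (Suc k)
  have "f k / (1 + f k) \<le> (real k + 1) / (real k + 2)"
    using f_pos[of k] f_le[of k] by (simp add: field_simps)
  then have "tail_weight f k * (f k / (1 + f k)) \<le> 1 / (real k + 1) * ((real k + 1) / (real k + 2))"
    using Suc.IH f_pos[of k] by (intro mult_mono) auto
  then show ?case by (simp add: tail_weight_def add.commute)
qed (simp add: tail_weight_0)

lemma sum_limit_weight: "(\<Sum>k<n. limit_weight f k) = 1 - tail_weight f n"
  unfolding limit_weight_eq_diff by (subst sum_lessThan_telescope') (simp add: tail_weight_0)

lemma limit_weight_sums_1: "limit_weight f sums 1"
proof -
  have "(\<lambda>n. 1 / (real n + 1)) \<longlonglongrightarrow> 0"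
    using LIMSEQ_inverse_real_of_nat by (simp add: inverse_eq_divide add.commute)
  then have "tail_weight f \<longlonglongrightarrow> 0"
    by (rule tendsto_sandwich[OF _ _ tendsto_const, rotated 2])
      (simp_all add: tail_weight_pos less_imp_le tail_weight_le_inverse)
  from tendsto_diff[OF tendsto_const[of 1] this] show ?thesis
    by (simp add: sums_def sum_limit_weight)
qed

text \<open>
Write \<open>S\<close> for a partial sum of \<open>tail_weight f (Suc k)\<close>. Each term is \<open>limit_weight f k * f k\<close>, which
is at most \<open>(\<eta> * k + 1) * limit_weight f k\<close>, while summation by parts bounds the partial sum of
\<open>k * limit_weight f k\<close> by \<open>S\<close>. Thus \<open>S \<le> \<eta> * S + 1\<close>.
\<close>
lemma summable_tail_weight:
  assumes \<eta>: "\<eta> < 1" and le: "\<And>k. f k \<le> \<eta> * real k + 1"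
  shows "summable (tail_weight f)"
proof -
  have tel: "(\<Sum>k<J. real k * limit_weight f k) \<le> (\<Sum>k<J. tail_weight f (Suc k))" for J
  proof -
    have "(\<Sum>k<J. real k * limit_weight f k) + real J * tail_weight f J \<le> (\<Sum>k<J. tail_weight f (Suc k))"
      by (induction J) (simp_all add: limit_weight_eq_diff algebra_simps)
    then show ?thesis using tail_weight_pos[of J] by (smt (verit) mult_nonneg_nonneg of_nat_0_le_iff)
  qed
  have \<eta>0: "0 \<le> \<eta>"
  proof (rule ccontr)
    assume "\<not> 0 \<le> \<eta>"
    then obtain k :: nat where "1 / (- \<eta>) < real k" using reals_Archimedean2 by blast
    then have "\<eta> * real k + 1 < 0" using \<open>\<not> 0 \<le> \<eta>\<close> by (simp add: field_simps)
    then show False using le[of k] f_pos[of k] by linarith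
  qed
  have "(\<Sum>k<J. tail_weight f (Suc k)) \<le> 1 / (1 - \<eta>)" for J
  proof -
    have "(\<Sum>k<J. tail_weight f (Suc k)) \<le> (\<Sum>k<J. \<eta> * (real k * limit_weight f k) + limit_weight f k)"
    proof (rule sum_mono)
      fix k
      have "limit_weight f k * f k \<le> limit_weight f k * (\<eta> * real k + 1)"
        using limit_weight_pos[of k] by (intro mult_left_mono le) simp
      then show "tail_weight f (Suc k) \<le> \<eta> * (real k * limit_weight f k) + limit_weight f k"
        unfolding limit_weight_times_f by (simp add: algebra_simps)
    qed
    also have "\<dots> = \<eta> * (\<Sum>k<J. real k * limit_weight f k) + (1 - tail_weight f J)"
      by (simp add: sum.distrib sum_distrib_left sum_limit_weight)
    also have "\<dots> \<le> \<eta> * (\<Sum>k<J. tail_weight f (Suc k)) + 1"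
      using \<eta>0 tel[of J] tail_weight_pos[of J] by (intro add_mono mult_left_mono) auto
    finally show ?thesis using \<eta> by (simp add: field_simps)
  qed
  then have "summable (\<lambda>k. tail_weight f (Suc k))"
    using tail_weight_pos by (intro summableI_nonneg_bounded) (auto intro: less_imp_le)
  then show ?thesis by (simp add: summable_Suc_iff)
qed

end

section \<open>Degree sums and their one-step increments\<close>

text \<open>
A functional of the graph rather than of the sample point, so that conditioning on the graph
simply fixes its value. At \<open>n = 0\<close> it is the empty sum for every graph.
\<close>
definition degree_sum :: "(nat \<Rightarrow> real) \<Rightarrow> nat \<Rightarrow> nat pair_pre_digraph \<Rightarrow> real" where
  "degree_sum \<phi> n g = (\<Sum>m=1..n. \<phi> (in_degree (with_proj g) m))"

lemma degree_sum_mono: "(\<And>z. \<phi> z \<le> \<psi> z) \<Longrightarrow> degree_sum \<phi> n g \<le> degree_sum \<psi> n g"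
  unfolding degree_sum_def by (intro sum_mono)

lemma degree_sum_nonneg: "(\<And>z. 0 \<le> \<phi> z) \<Longrightarrow> 0 \<le> degree_sum \<phi> n g"
  unfolding degree_sum_def by (intro sum_nonneg)

lemma degree_sum_add: "degree_sum (\<lambda>z. \<phi> z + \<psi> z) n g = degree_sum \<phi> n g + degree_sum \<psi> n g"
  by (simp add: degree_sum_def sum.distrib)

lemma degree_sum_diff: "degree_sum (\<lambda>z. \<phi> z - \<psi> z) n g = degree_sum \<phi> n g - degree_sum \<psi> n g"
  by (simp add: degree_sum_def sum_subtractf)

lemma degree_sum_cmult: "degree_sum (\<lambda>z. c * \<phi> z) n g = c * degree_sum \<phi> n g"
  by (simp add: degree_sum_def sum_distrib_left)

lemma degree_sum_sum: "degree_sum (\<lambda>z. \<Sum>k\<in>S. \<phi> k z) n g = (\<Sum>k\<in>S. degree_sum (\<phi> k) n g)"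
  unfolding degree_sum_def by (rule sum.swap)

lemma in_degree_with_proj: "in_degree (with_proj g) m = card {e \<in> parcs g. snd e = m}"
  by (simp add: in_degree_def in_arcs_def)

context preferential_attachment
begin

lemma graph_structure:
  assumes "1 \<le> n" "\<omega> \<in> space M"
  shows "pverts (G n \<omega>) = {1..n} \<and> parcs (G n \<omega>) \<subseteq> {1..n} \<times> {1..n}"
  using assms(1)
proof (induction n rule: nat_induct_at_least)
  case base
  then show ?case using initial_graph[OF assms(2)] by simp
next
  case (Suc n)
  obtain A where "A \<subseteq> {1..n}" "G (Suc n) \<omega> =
        \<lparr>pverts = insert (Suc n) (pverts (G n \<omega>)), parcs = parcs (G n \<omega>) \<union> {Suc n} \<times> A\<rparr>"
    using growth[OF Suc.hyps assms(2)] by blast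
  then show ?case using Suc.IH by auto
qed

lemma finite_parcs: "1 \<le> n \<Longrightarrow> \<omega> \<in> space M \<Longrightarrow> finite (parcs (G n \<omega>))"
  using graph_structure[of n \<omega>] by (meson finite_SigmaI finite_atLeastAtMost finite_subset)

text \<open>
With only finitely many graphs at each time, every functional of the graph is integrable and
conditional expectations are finite weighted sums.
\<close>
lemma finite_graphs:
  assumes "1 \<le> n" shows "finite (G n ` space M)"
proof (rule finite_subset)
  show "G n ` space M \<subseteq> (\<lambda>B. \<lparr>pverts = {1..n}, parcs = B\<rparr>) ` Pow ({1..n} \<times> {1..n})"
  proof
    fix g assume "g \<in> G n ` space M"
    then have "g = \<lparr>pverts = {1..n}, parcs = parcs g\<rparr>" "parcs g \<subseteq> {1..n} \<times> {1..n}"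
      using graph_structure[OF assms] by auto
    then show "g \<in> (\<lambda>B. \<lparr>pverts = {1..n}, parcs = B\<rparr>) ` Pow ({1..n} \<times> {1..n})" by blast
  qed
qed simp

lemma new_arcs:
  assumes n: "1 \<le> n" and \<omega>: "\<omega> \<in> space M"
  defines "A \<equiv> {m \<in> {1..n}. \<omega> \<in> arc_event M G n m}"
  shows "parcs (G (Suc n) \<omega>) = parcs (G n \<omega>) \<union> {Suc n} \<times> A"
proof -
  obtain A' where A': "A' \<subseteq> {1..n}" "G (Suc n) \<omega> =
        \<lparr>pverts = insert (Suc n) (pverts (G n \<omega>)), parcs = parcs (G n \<omega>) \<union> {Suc n} \<times> A'\<rparr>"
    using growth[OF n \<omega>] by blast
  have "(Suc n, m) \<notin> parcs (G n \<omega>)" for m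
    using graph_structure[OF n \<omega>] by auto
  then have "A = A'" using A' \<omega> by (auto simp: A_def arc_event_def)
  then show ?thesis using A' by simp
qed

lemma in_degree_Suc:
  assumes n: "1 \<le> n" and \<omega>: "\<omega> \<in> space M" and m: "m \<in> {1..n}"
  shows "in_degree (with_proj (G (Suc n) \<omega>)) m
     = in_degree (with_proj (G n \<omega>)) m + of_bool (\<omega> \<in> arc_event M G n m)"
proof -
  have eq: "{e \<in> parcs (G (Suc n) \<omega>). snd e = m} = (if \<omega> \<in> arc_event M G n m
      then insert (Suc n, m) {e \<in> parcs (G n \<omega>). snd e = m} else {e \<in> parcs (G n \<omega>). snd e = m})"
    unfolding new_arcs[OF n \<omega>] using m by auto
  have "(Suc n, m) \<notin> parcs (G n \<omega>)"
    using graph_structure[OF n \<omega>] by auto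
  then show ?thesis
    using finite_parcs[OF n \<omega>] by (simp add: in_degree_with_proj eq)
qed

lemma in_degree_new_vertex:
  assumes n: "1 \<le> n" and \<omega>: "\<omega> \<in> space M"
  shows "in_degree (with_proj (G (Suc n) \<omega>)) (Suc n) = 0"
proof -
  have "{e \<in> parcs (G (Suc n) \<omega>). snd e = Suc n} = {}"
    unfolding new_arcs[OF n \<omega>] using graph_structure[OF n \<omega>] by auto
  then show ?thesis by (simp only: in_degree_with_proj card.empty)
qed

lemma out_degree_new_vertex:
  assumes n: "1 \<le> n" and \<omega>: "\<omega> \<in> space M"
  shows "out_degree (with_proj (G (Suc n) \<omega>)) (Suc n) = card {m \<in> {1..n}. \<omega> \<in> arc_event M G n m}"
proof -
  have "{e \<in> parcs (G (Suc n) \<omega>). fst e = Suc n} = Pair (Suc n) ` {m \<in> {1..n}. \<omega> \<in> arc_event M G n m}"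
    unfolding new_arcs[OF n \<omega>] using graph_structure[OF n \<omega>] by auto
  then show ?thesis by (simp add: out_degree_def out_arcs_def card_image inj_on_def)
qed

text \<open>
For \<open>\<phi>\<close> that starts at 0 and increases by one exactly at the levels in \<open>P\<close>, the new vertex does
not contribute and an old vertex contributes one precisely if it is in a level in \<open>P\<close> and
receives an arc.
\<close>
lemma degree_sum_step:
  assumes n: "1 \<le> n" and \<omega>: "\<omega> \<in> space M"
    and \<phi>: "\<phi> 0 = 0" "\<And>z. \<phi> (Suc z) = \<phi> z + of_bool (P z)"
  shows "degree_sum \<phi> (Suc n) (G (Suc n) \<omega>) = degree_sum \<phi> n (G n \<omega>)
    + real (card {m \<in> {m \<in> {1..n}. P (in_degree (with_proj (G n \<omega>)) m)}. \<omega> \<in> arc_event M G n m})"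
proof -
  define D where "D m = {\<omega>'. P (in_degree (with_proj (G n \<omega>)) m) \<and> \<omega>' \<in> arc_event M G n m}" for m
  have "degree_sum \<phi> (Suc n) (G (Suc n) \<omega>)
      = (\<Sum>m=1..n. \<phi> (in_degree (with_proj (G (Suc n) \<omega>)) m))"
    unfolding degree_sum_def using in_degree_new_vertex[OF n \<omega>] \<phi>(1) by simp
  also have "\<dots> = (\<Sum>m=1..n. \<phi> (in_degree (with_proj (G n \<omega>)) m)
      + indicator (D m) \<omega>)"
    unfolding D_def using in_degree_Suc[OF n \<omega>] \<phi>(2) by (intro sum.cong) auto
  also have "\<dots> = degree_sum \<phi> n (G n \<omega>)
      + real (card {m \<in> {1..n}. \<omega> \<in> D m})"
    by (simp add: sum.distrib degree_sum_def sum_indicator_eq_card_Collect)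
  also have "{m \<in> {1..n}. \<omega> \<in> D m}
      = {m \<in> {m \<in> {1..n}. P (in_degree (with_proj (G n \<omega>)) m)}. \<omega> \<in> arc_event M G n m}"
    by (auto simp: D_def)
  finally show ?thesis .
qed

lemma degree_sum_incseq:
  assumes \<omega>: "\<omega> \<in> space M"
    and \<phi>: "\<phi> 0 = 0" "\<And>z. \<phi> (Suc z) = \<phi> z + of_bool (P z)"
  shows "mono (\<lambda>n. degree_sum \<phi> n (G n \<omega>))"
proof (rule incseq_SucI)
  fix n show "degree_sum \<phi> n (G n \<omega>) \<le> degree_sum \<phi> (Suc n) (G (Suc n) \<omega>)"
  proof (cases "n = 0")
    case True
    then show ?thesis using initial_graph[OF \<omega>] \<phi>(1) by (simp add: degree_sum_def in_degree_with_proj)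
  next
    case False
    then show ?thesis using degree_sum_step[OF _ \<omega>, of n \<phi> P, OF _ \<phi>] by simp
  qed
qed

lemma graph_event [measurable]: "1 \<le> n \<Longrightarrow> {\<omega> \<in> space M. G n \<omega> \<in> S} \<in> events"
  using measurable_sets[OF measurable_graph, of n S] by (simp add: vimage_def Int_def conj_commute)

lemma graph_event_eq: "1 \<le> n \<Longrightarrow> {\<omega> \<in> space M. G n \<omega> = g} \<in> events"
  using graph_event[of n "{g}"] by simp

lemma integrable_graph:
  fixes h :: "nat pair_pre_digraph \<Rightarrow> real"
  assumes "1 \<le> n" shows "integrable M (\<lambda>\<omega>. h (G n \<omega>))"
proof (rule integrable_const_bound)
  show "AE \<omega> in M. norm (h (G n \<omega>)) \<le> Max ((\<lambda>g. norm (h g)) ` G n ` space M)"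
    using finite_graphs[OF assms] by (intro AE_I2 Max_ge) auto
  show "(\<lambda>\<omega>. h (G n \<omega>)) \<in> borel_measurable M"
    using measurable_graph[OF assms] by (rule measurable_compose) simp
qed

lemma arc_event_measurable: "1 \<le> n \<Longrightarrow> arc_event M G n m \<in> events"
  unfolding arc_event_def using graph_event[of "Suc n" "{g. (Suc n, m) \<in> parcs g}"] by simp

lemma prob_space_given_graph:
  assumes "1 \<le> n" "0 < prob {\<omega> \<in> space M. G n \<omega> = g}"
  shows "prob_space (given_graph M G n g)"
  unfolding given_graph_def using assms(2)
  by (intro prob_space_uniform_measure) (auto simp: emeasure_eq_measure)

lemma integral_given_graph:
  fixes h :: "'w \<Rightarrow> real"
  assumes n: "1 \<le> n" and pos: "0 < prob {\<omega> \<in> space M. G n \<omega> = g}" and [measurable]: "h \<in> borel_measurable M"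
  shows "prob {\<omega> \<in> space M. G n \<omega> = g} * (\<integral>\<omega>. h \<omega> \<partial>given_graph M G n g)
    = (\<integral>\<omega>. indicator {\<omega> \<in> space M. G n \<omega> = g} \<omega> * h \<omega> \<partial>M)"
proof -
  define E where "E = {\<omega> \<in> space M. G n \<omega> = g}"
  have [measurable]: "E \<in> events" unfolding E_def by (rule graph_event_eq[OF n])
  have p: "0 < prob E" using pos by (simp add: E_def)
  have "given_graph M G n g = density M (\<lambda>\<omega>. ennreal (indicator E \<omega> / prob E))"
    unfolding given_graph_def E_def[symmetric] uniform_measure_def
    using p by (intro arg_cong2[where f = density] refl ext)
      (auto simp: emeasure_eq_measure divide_ennreal[symmetric] split: split_indicator)
  then have "(\<integral>\<omega>. h \<omega> \<partial>given_graph M G n g) = (\<integral>\<omega>. indicator E \<omega> / prob E * h \<omega> \<partial>M)"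
    using p by (simp add: integral_density)
  also have "\<dots> = (\<integral>\<omega>. indicator E \<omega> * h \<omega> \<partial>M) / prob E"
    by simp
  finally show ?thesis using p by (simp add: E_def)
qed

text \<open>
The law of total expectation. The integrand depends on the graph through a parameter, so that it
can be frozen at \<open>g\<close> under the measure conditioned on \<open>G n = g\<close>; graphs of probability 0, for which
the conditioned measure carries no information, are left out of the sum.
\<close>
lemma integral_condition_on_graph:
  fixes h :: "nat pair_pre_digraph \<Rightarrow> 'w \<Rightarrow> real"
  assumes n: "1 \<le> n" and h: "\<And>g. integrable M (h g)"
  shows "integrable M (\<lambda>\<omega>. h (G n \<omega>) \<omega>)"
    and "(\<integral>\<omega>. h (G n \<omega>) \<omega> \<partial>M) = (\<Sum>g | g \<in> G n ` space M \<and> 0 < prob {\<omega> \<in> space M. G n \<omega> = g}.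
      prob {\<omega> \<in> space M. G n \<omega> = g} * (\<integral>\<omega>. h g \<omega> \<partial>given_graph M G n g))"
proof -
  define V where "V = G n ` space M"
  have V: "finite V" unfolding V_def by (rule finite_graphs[OF n])
  define E where "E g = {\<omega> \<in> space M. G n \<omega> = g}" for g
  have E[measurable]: "E g \<in> events" for g unfolding E_def by (rule graph_event_eq[OF n])
  have dec: "h (G n \<omega>) \<omega> = (\<Sum>g\<in>V. indicator (E g) \<omega> * h g \<omega>)" if "\<omega> \<in> space M" for \<omega>
  proof -
    have "(\<Sum>g\<in>V. indicator (E g) \<omega> * h g \<omega>) = (\<Sum>g\<in>V. if g = G n \<omega> then h g \<omega> else 0)"
      using that by (intro sum.cong) (auto simp: E_def)
    also have "\<dots> = h (G n \<omega>) \<omega>" using V that by (simp add: V_def)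
    finally show ?thesis by simp
  qed
  have int: "integrable M (\<lambda>\<omega>. indicator (E g) \<omega> * h g \<omega>)" for g
    using integrable_mult_indicator[OF E h, of g g] by simp
  show "integrable M (\<lambda>\<omega>. h (G n \<omega>) \<omega>)"
    using int by (subst Bochner_Integration.integrable_cong[OF refl dec]) auto
  have "(\<integral>\<omega>. h (G n \<omega>) \<omega> \<partial>M) = (\<Sum>g\<in>V. (\<integral>\<omega>. indicator (E g) \<omega> * h g \<omega> \<partial>M))"
    using int by (subst Bochner_Integration.integral_cong[OF refl dec]) auto
  also have "\<dots> = (\<Sum>g | g \<in> V \<and> 0 < prob (E g). (\<integral>\<omega>. indicator (E g) \<omega> * h g \<omega> \<partial>M))"
  proof (rule sum.mono_neutral_right[OF V])
    show "\<forall>g\<in>V - {g \<in> V. 0 < prob (E g)}. (\<integral>\<omega>. indicator (E g) \<omega> * h g \<omega> \<partial>M) = 0"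
    proof
      fix g assume "g \<in> V - {g \<in> V. 0 < prob (E g)}"
      then have "prob (E g) = 0" by (auto simp: not_less measure_le_0_iff)
      then have "E g \<in> null_sets M" using E by (auto simp: null_sets_def emeasure_eq_measure)
      then have "AE \<omega> in M. indicator (E g) \<omega> * h g \<omega> = 0"
        by (rule AE_not_in[THEN AE_mp]) (auto simp: indicator_def)
      then show "(\<integral>\<omega>. indicator (E g) \<omega> * h g \<omega> \<partial>M) = 0" by (rule integral_eq_zero_AE)
    qed
  qed auto
  also have "\<dots> = (\<Sum>g | g \<in> V \<and> 0 < prob (E g). prob (E g) * (\<integral>\<omega>. h g \<omega> \<partial>given_graph M G n g))"
    using integral_given_graph[OF n] h by (intro sum.cong refl) (auto simp: E_def)
  finally show "(\<integral>\<omega>. h (G n \<omega>) \<omega> \<partial>M) = (\<Sum>g | g \<in> G n ` space M \<and> 0 < prob {\<omega> \<in> space M. G n \<omega> = g}.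
      prob {\<omega> \<in> space M. G n \<omega> = g} * (\<integral>\<omega>. h g \<omega> \<partial>given_graph M G n g))"
    by (simp add: V_def E_def)
qed

text \<open>
The conditional mean, given the graph \<open>g\<close> at time \<open>n\<close>, of the number of new arcs into
vertices with indegree in \<open>P\<close>.
\<close>
definition arc_mean :: "(nat \<Rightarrow> bool) \<Rightarrow> nat \<Rightarrow> nat pair_pre_digraph \<Rightarrow> real" where
  "arc_mean P n g = degree_sum (\<lambda>z. of_bool (P z) * f z) n g / real n"

text \<open>
The one probabilistic estimate behind both parts: the increment centred at its conditional mean
is orthogonal to functionals of the current graph, and its conditional variance is at most that
mean. All recursions arise by choosing \<open>\<phi>\<close> and \<open>y\<close>.
\<close>
lemma second_moment_step:
  fixes y :: "nat pair_pre_digraph \<Rightarrow> real"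
  assumes n: "1 \<le> n" and \<phi>: "\<phi> 0 = 0" "\<And>z. \<phi> (Suc z) = \<phi> z + of_bool (P z)"
  shows "(\<integral>\<omega>. (y (G n \<omega>) + (degree_sum \<phi> (Suc n) (G (Suc n) \<omega>) - degree_sum \<phi> n (G n \<omega>))
      - arc_mean P n (G n \<omega>))\<^sup>2 \<partial>M) \<le> (\<integral>\<omega>. (y (G n \<omega>))\<^sup>2 + arc_mean P n (G n \<omega>) \<partial>M)"
proof -
  define J where "J g = {m \<in> {1..n}. P (in_degree (with_proj g) m)}" for g
  define h where "h g \<omega> = (y g + real (card {m \<in> J g. \<omega> \<in> arc_event M G n m}) - arc_mean P n g)\<^sup>2" for g \<omega>
  define h' where "h' g (\<omega>::'w) = (y g)\<^sup>2 + arc_mean P n g" for g \<omega>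
  have "(\<integral>\<omega>. (y (G n \<omega>) + (degree_sum \<phi> (Suc n) (G (Suc n) \<omega>) - degree_sum \<phi> n (G n \<omega>))
      - arc_mean P n (G n \<omega>))\<^sup>2 \<partial>M) = (\<integral>\<omega>. h (G n \<omega>) \<omega> \<partial>M)"
    by (intro Bochner_Integration.integral_cong refl)
      (simp add: h_def J_def degree_sum_step[where P = P, OF n _ \<phi>])
  also have "\<dots> = (\<Sum>g | g \<in> G n ` space M \<and> 0 < prob {\<omega> \<in> space M. G n \<omega> = g}.
      prob {\<omega> \<in> space M. G n \<omega> = g} * (\<integral>\<omega>. h g \<omega> \<partial>given_graph M G n g))"
  proof (rule integral_condition_on_graph(2)[OF n])
    fix g
    have "integrable M (\<lambda>\<omega>. (\<lambda>g'. (y g + real (card {m \<in> J g. (Suc n, m) \<in> parcs g'}) - arc_mean P n g)\<^sup>2) (G (Suc n) \<omega>))"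
      by (rule integrable_graph) simp
    then show "integrable M (h g)"
      by (rule Bochner_Integration.integrable_cong[THEN iffD1, OF refl, rotated])
        (simp add: h_def arc_event_def)
  qed
  also have "\<dots> \<le> (\<Sum>g | g \<in> G n ` space M \<and> 0 < prob {\<omega> \<in> space M. G n \<omega> = g}.
      prob {\<omega> \<in> space M. G n \<omega> = g} * (\<integral>\<omega>. h' g \<omega> \<partial>given_graph M G n g))"
  proof (intro sum_mono mult_left_mono)
    fix g assume "g \<in> {g. g \<in> G n ` space M \<and> 0 < prob {\<omega> \<in> space M. G n \<omega> = g}}"
    then have g: "0 < prob {\<omega> \<in> space M. G n \<omega> = g}" by simp
    interpret Q: prob_space "given_graph M G n g" by (rule prob_space_given_graph[OF n g])
    have "(\<Sum>j\<in>J g. Q.prob (arc_event M G n j)) = (\<Sum>j\<in>J g. f (in_degree (with_proj g) j) / real n)"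
      using prob_arc[OF n g] by (intro sum.cong) (auto simp: J_def)
    also have "\<dots> = arc_mean P n g"
      by (simp add: arc_mean_def degree_sum_def J_def sum.inter_filter sum_divide_distrib if_distrib
          cong: if_cong) (auto intro!: sum.cong)
    finally have b: "(\<Sum>j\<in>J g. Q.prob (arc_event M G n j)) = arc_mean P n g" .
    have "(\<integral>\<omega>. h g \<omega> \<partial>given_graph M G n g) \<le> (y g)\<^sup>2 + arc_mean P n g"
      unfolding h_def b[symmetric]
      by (rule Q.integral_centered_card_square[OF indep_arcs[OF n g]]) (auto simp: J_def)
    then show "(\<integral>\<omega>. h g \<omega> \<partial>given_graph M G n g) \<le> (\<integral>\<omega>. h' g \<omega> \<partial>given_graph M G n g)"
      by (simp add: h'_def Q.prob_space)
  qed simp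
  also have "\<dots> = (\<integral>\<omega>. h' (G n \<omega>) \<omega> \<partial>M)"
    by (rule integral_condition_on_graph(2)[OF n, symmetric]) (simp add: h'_def)
  finally show ?thesis by (simp add: h'_def)
qed

text \<open>
Monotone convergence; the series is shifted by one because the graph at time 0 is arbitrary.
\<close>
lemma AE_summable_of_summable_expectation:
  fixes y :: "nat \<Rightarrow> nat pair_pre_digraph \<Rightarrow> real"
  assumes y: "\<And>n g. 0 \<le> y n g"
    and sum: "summable (\<lambda>n. (\<integral>\<omega>. y n (G n \<omega>) \<partial>M) / real (Suc n))"
  shows "AE \<omega> in M. summable (\<lambda>n. y n (G n \<omega>) / real (Suc n))"
proof -
  define Y where "Y n \<omega> = y (Suc n) (G (Suc n) \<omega>) / real (Suc (Suc n))" for n \<omega>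
  have Yi: "integrable M (Y n)" for n
    unfolding Y_def by (intro integrable_divide integrable_graph) simp
  then have [measurable]: "Y n \<in> borel_measurable M" for n by auto
  have Y0: "0 \<le> Y n \<omega>" for n \<omega> using y by (simp add: Y_def)
  have sumY: "summable (\<lambda>n. \<integral>\<omega>. Y n \<omega> \<partial>M)"
    using sum by (subst (asm) summable_Suc_iff[symmetric]) (simp add: Y_def)
  have "(\<integral>\<^sup>+\<omega>. (\<Sum>n. ennreal (Y n \<omega>)) \<partial>M) = (\<Sum>n. \<integral>\<^sup>+\<omega>. ennreal (Y n \<omega>) \<partial>M)"
    by (rule nn_integral_suminf) simp
  also have "\<dots> = (\<Sum>n. ennreal (\<integral>\<omega>. Y n \<omega> \<partial>M))"
    using Yi Y0 by (simp add: nn_integral_eq_integral)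
  also have "\<dots> = ennreal (\<Sum>n. \<integral>\<omega>. Y n \<omega> \<partial>M)"
    using sumY Y0 by (intro suminf_ennreal2) (auto intro: integral_nonneg)
  finally have "(\<integral>\<^sup>+\<omega>. (\<Sum>n. ennreal (Y n \<omega>)) \<partial>M) \<noteq> \<infinity>" by simp
  then have "AE \<omega> in M. (\<Sum>n. ennreal (Y n \<omega>)) \<noteq> \<infinity>"
    by (intro nn_integral_PInf_AE) auto
  then show ?thesis
  proof eventually_elim
    case (elim \<omega>)
    then have "summable (\<lambda>n. Y n \<omega>)"
      using Y0 by (intro summable_suminf_not_top) auto
    then show ?case by (subst summable_Suc_iff[symmetric]) (simp add: Y_def)
  qed
qed

end

section \<open>Convergence of the empirical indegree distribution\<close>

locale attachment_network = preferential_attachment +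
  assumes rule: "attachment_rule f"
begin

abbreviation tail_count :: "nat \<Rightarrow> nat \<Rightarrow> nat pair_pre_digraph \<Rightarrow> real" where
  "tail_count k \<equiv> degree_sum (\<lambda>z. of_bool (k \<le> z))"

abbreviation excess :: "nat \<Rightarrow> nat \<Rightarrow> nat pair_pre_digraph \<Rightarrow> real" where
  "excess K \<equiv> degree_sum (\<lambda>z. real (z - K))"

definition tail_error :: "nat \<Rightarrow> nat \<Rightarrow> nat pair_pre_digraph \<Rightarrow> real" where
  "tail_error k n g = tail_count k n g / real n - tail_weight f k"

lemma tail_count_bounds: "0 \<le> tail_count k n g" "tail_count k n g \<le> real n"
proof -
  show "0 \<le> tail_count k n g" by (rule degree_sum_nonneg) simp
  have "tail_count k n g \<le> degree_sum (\<lambda>z. 1) n g" by (rule degree_sum_mono) simp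
  then show "tail_count k n g \<le> real n" by (simp add: degree_sum_def)
qed

lemma tail_error_abs_le_1: "\<bar>tail_error k n g\<bar> \<le> 1"
proof -
  have "0 \<le> tail_count k n g / real n" "tail_count k n g / real n \<le> 1"
    using tail_count_bounds[of k n g] by (auto simp: divide_le_eq_1)
  then show ?thesis
    using tail_weight_pos[OF rule, of k] tail_weight_le_1[OF rule, of k]
    by (simp add: tail_error_def abs_le_iff)
qed

lemma arc_mean_level: "arc_mean (\<lambda>z. z = k) n g = f k * (tail_count k n g - tail_count (Suc k) n g) / real n"
proof -
  have "(\<lambda>z. of_bool (z = k) * f z) = (\<lambda>z. f k * (of_bool (k \<le> z) - of_bool (Suc k \<le> z)))"
    by (auto simp: fun_eq_iff)
  then show ?thesis unfolding arc_mean_def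
    by (simp only: degree_sum_cmult degree_sum_diff)
qed

text \<open>
By the balance equation, \<open>(n + 1)\<close> times the deviation at time \<open>n + 1\<close> is the combination
\<open>(n - f k) * (deviation of level k + 1) + f k * (deviation of level k)\<close> at time \<open>n\<close>, plus the centred
increment. The coefficients are nonnegative as soon as \<open>n > k\<close>, by \<open>f k \<le> k + 1\<close>, and they add
up to \<open>n\<close>, so convexity applies.
\<close>
lemma tail_error_Suc_recursion:
  assumes n: "Suc k \<le> n"
  defines "v \<equiv> \<lambda>k n. \<integral>\<omega>. (tail_error k n (G n \<omega>))\<^sup>2 \<partial>M"
  shows "v (Suc k) (Suc n) \<le> (1 - (1 + f k) / real (Suc n)) * v (Suc k) n
     + (f k / real (Suc n) * v k n + f k / (real (Suc n))\<^sup>2)"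
proof -
  have n1: "1 \<le> n" and fk: "0 < f k" "f k \<le> real n"
    using n f_pos[OF rule, of k] f_le[OF rule, of k] by auto
  let ?\<phi> = "\<lambda>z. of_bool (Suc k \<le> z) :: real"
  let ?P = "\<lambda>z. z = k"
  have \<phi>: "?\<phi> 0 = 0" "\<And>z. ?\<phi> (Suc z) = ?\<phi> z + of_bool (?P z)" by auto
  define y where "y g = (real n - f k) * tail_error (Suc k) n g + f k * tail_error k n g" for g
  \<comment> \<open>the terms without randomness cancel by the balance equation\<close>
  have y_eq: "y g = tail_count (Suc k) n g + arc_mean ?P n g - real (Suc n) * tail_weight f (Suc k)" for g
  proof -
    have "f k * tail_weight f k = tail_weight f (Suc k) + f k * tail_weight f (Suc k)"
      using tail_weight_Suc[OF rule, of k] by (simp add: algebra_simps)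
    then show ?thesis using n1
      by (simp add: y_def tail_error_def arc_mean_level field_simps)
  qed
  have step: "real (Suc n) * tail_error (Suc k) (Suc n) (G (Suc n) \<omega>)
     = y (G n \<omega>) + (tail_count (Suc k) (Suc n) (G (Suc n) \<omega>) - tail_count (Suc k) n (G n \<omega>)) - arc_mean ?P n (G n \<omega>)" for \<omega>
    by (simp add: y_eq tail_error_def right_diff_distrib del: of_nat_Suc)
  have b: "arc_mean ?P n g \<le> f k" for g
  proof -
    have "tail_count k n g - tail_count (Suc k) n g \<le> real n"
      using tail_count_bounds(2)[of k n g] tail_count_bounds(1)[of "Suc k" n g] by linarith
    then have "f k * (tail_count k n g - tail_count (Suc k) n g) \<le> f k * real n"
      using fk by (intro mult_left_mono) auto
    then show ?thesis using n1 by (simp add: arc_mean_level divide_le_eq)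
  qed
  have "(real (Suc n))\<^sup>2 * v (Suc k) (Suc n) = (\<integral>\<omega>. (real (Suc n) * tail_error (Suc k) (Suc n) (G (Suc n) \<omega>))\<^sup>2 \<partial>M)"
    by (simp add: v_def power_mult_distrib del: of_nat_Suc)
  also have "\<dots> \<le> (\<integral>\<omega>. (y (G n \<omega>))\<^sup>2 + arc_mean ?P n (G n \<omega>) \<partial>M)"
    unfolding step by (rule second_moment_step[where \<phi> = ?\<phi>, OF n1 \<phi>])
  also have "\<dots> \<le> (\<integral>\<omega>. real (Suc n) * ((real n - f k) * (tail_error (Suc k) n (G n \<omega>))\<^sup>2
      + f k * (tail_error k n (G n \<omega>))\<^sup>2) + f k \<partial>M)"
  proof (rule integral_mono)
    show "integrable M (\<lambda>\<omega>. (y (G n \<omega>))\<^sup>2 + arc_mean ?P n (G n \<omega>))"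
      by (rule integrable_graph[OF n1, of "\<lambda>g. (y g)\<^sup>2 + arc_mean ?P n g"])
    show "integrable M (\<lambda>\<omega>. real (Suc n) * ((real n - f k) * (tail_error (Suc k) n (G n \<omega>))\<^sup>2
      + f k * (tail_error k n (G n \<omega>))\<^sup>2) + f k)"
      by (rule integrable_graph[OF n1, of "\<lambda>g. real (Suc n) * ((real n - f k) * (tail_error (Suc k) n g)\<^sup>2
      + f k * (tail_error k n g)\<^sup>2) + f k"])
    show "(y (G n \<omega>))\<^sup>2 + arc_mean ?P n (G n \<omega>) \<le> real (Suc n) * ((real n - f k) * (tail_error (Suc k) n (G n \<omega>))\<^sup>2
      + f k * (tail_error k n (G n \<omega>))\<^sup>2) + f k" for \<omega>
      unfolding y_def using fk by (intro add_mono weighted_square_le b) auto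
  qed
  also have "\<dots> = real (Suc n) * ((real n - f k) * v (Suc k) n + f k * v k n) + f k"
  proof -
    have [simp]: "integrable M (\<lambda>\<omega>. (tail_error j n (G n \<omega>))\<^sup>2)" for j
      by (rule integrable_graph[OF n1, of "\<lambda>g. (tail_error j n g)\<^sup>2"])
    show ?thesis by (simp add: v_def prob_space del: of_nat_Suc)
  qed
  finally have "v (Suc k) (Suc n) \<le> (real (Suc n) * ((real n - f k) * v (Suc k) n + f k * v k n) + f k) / (real (Suc n))\<^sup>2"
    by (simp add: pos_le_divide_eq mult.commute del: of_nat_Suc)
  also have "\<dots> = (1 - (1 + f k) / real (Suc n)) * v (Suc k) n
     + (f k / real (Suc n) * v k n + f k / (real (Suc n))\<^sup>2)"
  proof -
    have "1 - (1 + f k) / real (Suc n) = (real n - f k) / real (Suc n)" by (simp add: field_simps)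
    then show ?thesis
      by (simp add: add_divide_distrib power2_eq_square del: of_nat_Suc)
  qed
  finally show ?thesis .
qed

lemma summable_tail_error:
  "summable (\<lambda>n. (\<integral>\<omega>. (tail_error k n (G n \<omega>))\<^sup>2 \<partial>M) / real (Suc n))"
proof (induction k)
  case 0
  have "tail_error 0 n g = 0" if "n \<noteq> 0" for n g
    using that by (simp add: tail_error_def degree_sum_def tail_weight_0[OF rule])
  then show ?case by (intro summable_finite[of "{0}"]) auto
next
  case (Suc k)
  have "summable (\<lambda>n. f k / real (Suc n) * (\<integral>\<omega>. (tail_error k n (G n \<omega>))\<^sup>2 \<partial>M) + f k / (real (Suc n))\<^sup>2)"
    using summable_add[OF summable_mult[OF Suc.IH, of "f k"] summable_divide_Suc_square[of "f k"]]
    by (simp del: of_nat_Suc)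
  then show ?case
    using tail_error_Suc_recursion[of k] f_pos[OF rule, of k]
    by (intro summable_of_contracting_recursion[where a = "1 + f k" and start = "Suc k"]) (auto simp del: of_nat_Suc)
qed

text \<open>
The weighted series of squared deviations converges almost surely, and monotonicity of the counts
in \<open>n\<close> upgrades this to convergence of the deviations.
\<close>
lemma AE_tail_frequency:
  "AE \<omega> in M. \<forall>k. (\<lambda>n. tail_count k n (G n \<omega>) / real n) \<longlonglongrightarrow> tail_weight f k"
proof (subst AE_all_countable, rule allI)
  fix k
  show "AE \<omega> in M. (\<lambda>n. tail_count k n (G n \<omega>) / real n) \<longlonglongrightarrow> tail_weight f k"
  proof (cases k)
    case 0
    have "(\<lambda>n. tail_count 0 n (G n \<omega>) / real n) \<longlonglongrightarrow> tail_weight f 0" for \<omega>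
      by (rule tendsto_eventually)
        (auto simp: degree_sum_def tail_weight_0[OF rule] intro!: eventually_sequentiallyI[of 1])
    then show ?thesis using 0 by simp
  next
    case (Suc j)
    have "AE \<omega> in M. summable (\<lambda>n. (tail_error k n (G n \<omega>))\<^sup>2 / real (Suc n))"
      by (rule AE_summable_of_summable_expectation[OF _ summable_tail_error]) simp
    then show ?thesis
    proof (rule AE_mp, intro AE_I2 impI)
      fix \<omega> assume \<omega>: "\<omega> \<in> space M" and sum: "summable (\<lambda>n. (tail_error k n (G n \<omega>))\<^sup>2 / real (Suc n))"
      let ?a = "\<lambda>n. tail_count k n (G n \<omega>)"
      have mono: "mono ?a"
        by (rule degree_sum_incseq[OF \<omega>, where P = "\<lambda>z. z = j"]) (auto simp: Suc)
      have sum2: "summable (\<lambda>n. (?a n / real n - tail_weight f k)\<^sup>2 / real (Suc n))"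
        using sum by (simp add: tail_error_def)
      have sum1: "summable (\<lambda>n. (max 0 (?a n / real n - tail_weight f k))\<^sup>2 / real (Suc n))"
        by (rule summable_comparison_test'[OF sum2])
          (auto simp: max_def intro!: divide_right_mono)
      show "(\<lambda>n. ?a n / real n) \<longlonglongrightarrow> tail_weight f k"
      proof (rule order_tendstoI)
        fix l assume "l < tail_weight f k"
        then show "\<forall>\<^sub>F n in sequentially. l < ?a n / real n"
          using eventually_lower_of_weighted_summable[OF mono tail_count_bounds(1) sum2, of "tail_weight f k - l"] by simp
      next
        fix u assume "tail_weight f k < u"
        then show "\<forall>\<^sub>F n in sequentially. ?a n / real n < u"
          using eventually_upper_of_weighted_summable[OF mono _ sum1, of "u - tail_weight f k"]
            tail_weight_pos[OF rule, of k] by simp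
      qed
    qed
  qed
qed

lemma empirical_indegree_eq:
  "empirical_indegree G n \<omega> k = tail_count k n (G n \<omega>) / real n - tail_count (Suc k) n (G n \<omega>) / real n"
proof -
  have "(\<lambda>z. of_bool (z = k) :: real) = (\<lambda>z. of_bool (k \<le> z) - of_bool (Suc k \<le> z))"
    by (auto simp: fun_eq_iff)
  then have "degree_sum (\<lambda>z. of_bool (z = k)) n (G n \<omega>) = tail_count k n (G n \<omega>) - tail_count (Suc k) n (G n \<omega>)"
    by (simp only: degree_sum_diff)
  then show ?thesis
    by (simp add: empirical_indegree_def indegree_def degree_sum_def diff_divide_distrib)
qed

lemma empirical_indegree_sums_1:
  assumes "1 \<le> n" shows "empirical_indegree G n \<omega> sums 1"
proof -
  have "(\<lambda>k. of_bool (indegree G i n \<omega> = k) :: real) sums 1" for i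
    using sums_single[of "indegree G i n \<omega>" "\<lambda>_. 1 :: real"] by (simp add: of_bool_def eq_commute)
  then have "(\<lambda>k. \<Sum>i=1..n. of_bool (indegree G i n \<omega> = k) :: real) sums (\<Sum>i=1..n. 1)"
    by (intro sums_sum)
  from sums_mult[OF this, of "1 / real n"] show ?thesis
    using assms by (simp add: empirical_indegree_def[abs_def])
qed

lemma AE_empirical_indegree_tendsto:
  "AE \<omega> in M. (\<lambda>n. tv_norm (\<lambda>k. empirical_indegree G n \<omega> k - limit_weight f k)) \<longlonglongrightarrow> 0"
  using AE_tail_frequency
proof eventually_elim
  case (elim \<omega>)
  have "(\<lambda>n. tv_norm (\<lambda>k. empirical_indegree G (Suc n) \<omega> k - limit_weight f k)) \<longlonglongrightarrow> 0"
  proof (rule tv_norm_tendsto_0_Scheffe)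
    show "0 \<le> empirical_indegree G (Suc n) \<omega> k" for n k
      by (simp add: empirical_indegree_def sum_nonneg)
    show "0 \<le> limit_weight f k" for k using limit_weight_pos[OF rule, of k] by simp
    show "empirical_indegree G (Suc n) \<omega> sums 1" for n by (rule empirical_indegree_sums_1) simp
    show "limit_weight f sums 1" by (rule limit_weight_sums_1[OF rule])
    fix k
    have "(\<lambda>n. empirical_indegree G n \<omega> k) \<longlonglongrightarrow> limit_weight f k"
      unfolding empirical_indegree_eq limit_weight_eq_diff[OF rule]
      using elim by (intro tendsto_diff) auto
    then show "(\<lambda>n. empirical_indegree G (Suc n) \<omega> k) \<longlonglongrightarrow> limit_weight f k"
      by (rule LIMSEQ_Suc)
  qed
  then show ?case by (rule LIMSEQ_imp_Suc)
qed

section \<open>The contribution of vertices of large indegree\<close>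

text \<open>
The fixed point of the drift of \<open>excess K n / n\<close> when \<open>f k\<close> is replaced by its bound
\<open>\<eta> * k + 1\<close> and the proportion of vertices of indegree at least \<open>K\<close> by its limit.
\<close>
definition excess_bound :: "real \<Rightarrow> nat \<Rightarrow> real" where
  "excess_bound \<eta> K = (\<eta> * real K + 1) * tail_weight f K / (1 - \<eta>)"

definition excess_overshoot :: "real \<Rightarrow> nat \<Rightarrow> nat \<Rightarrow> nat pair_pre_digraph \<Rightarrow> real" where
  "excess_overshoot \<eta> K n g = max 0 (excess K n g / real n - excess_bound \<eta> K)"

lemma arc_mean_excess_le:
  assumes \<eta>: "0 < \<eta>" and le: "\<And>k. f k \<le> \<eta> * real k + 1"
  shows "arc_mean (\<lambda>z. K \<le> z) n g \<le> (\<eta> * excess K n g + (\<eta> * real K + 1) * tail_count K n g) / real n"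
proof -
  have "degree_sum (\<lambda>z. of_bool (K \<le> z) * f z) n g
      \<le> degree_sum (\<lambda>z. \<eta> * real (z - K) + (\<eta> * real K + 1) * of_bool (K \<le> z)) n g"
  proof (rule degree_sum_mono)
    fix z show "of_bool (K \<le> z) * f z \<le> \<eta> * real (z - K) + (\<eta> * real K + 1) * of_bool (K \<le> z)"
      using le[of z] by (cases "K \<le> z") (simp_all add: of_nat_diff algebra_simps)
  qed
  also have "\<dots> = \<eta> * excess K n g + (\<eta> * real K + 1) * tail_count K n g"
    by (simp only: degree_sum_add degree_sum_cmult)
  finally show ?thesis by (simp add: arc_mean_def divide_right_mono)
qed

text \<open>
The drift of the excess is only bounded above, so the recursion is for the positive part of the
deviation: passing from \<open>D\<close> to \<open>D + \<xi>\<close>, the positive part of the result is at most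
\<open>\<bar>max 0 D + \<xi>\<bar>\<close>, and \<open>second_moment_step\<close> applies with \<open>y\<close> a positive part. The conditional variance is
itself controlled by the deviation; this is why the contraction constant is \<open>\<gamma> / 2\<close> instead of
\<open>\<gamma> = 1 - \<eta>\<close>, with the difference absorbing that contribution for large \<open>n\<close>.
\<close>
lemma excess_recursion:
  fixes \<eta> :: real and K :: nat
  assumes \<eta>: "0 < \<eta>" "\<eta> < 1" and le: "\<And>k. f k \<le> \<eta> * real k + 1" 
  defines "L \<equiv> \<eta> * real K + 1" and "\<gamma> \<equiv> 1 - \<eta>" and "c \<equiv> excess_bound \<eta> K"
  defines "v \<equiv> \<lambda>n. \<integral>\<omega>. (excess_overshoot \<eta> K n (G n \<omega>))\<^sup>2 \<partial>M"
    and "w \<equiv> \<lambda>n. \<integral>\<omega>. (tail_error K n (G n \<omega>))\<^sup>2 \<partial>M"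
  assumes n: "1 \<le> n" "2 * \<eta> / \<gamma> \<le> real n"
  shows "v (Suc n) \<le> (1 - (\<gamma> / 2) / real (Suc n)) * v n
     + (L\<^sup>2 / \<gamma> * (w n / real (Suc n)) + (\<eta> + c + L) / (real (Suc n))\<^sup>2)"
proof -
  have \<gamma>: "0 < \<gamma>" and L: "0 < L" and c0: "0 \<le> c" and n1: "1 \<le> n"
    using \<eta> n tail_weight_pos[OF rule, of K] by (auto simp: \<gamma>_def L_def c_def excess_bound_def add_nonneg_pos)
  have c: "\<gamma> * c = L * tail_weight f K"
    using \<eta> by (simp add: \<gamma>_def c_def excess_bound_def L_def)
  let ?\<phi> = "\<lambda>z. real (z - K)"
  let ?P = "\<lambda>z. K \<le> z"
  have \<phi>: "?\<phi> 0 = 0" "\<And>z. ?\<phi> (Suc z) = ?\<phi> z + of_bool (?P z)" by (auto simp: Suc_diff_le)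
  let ?d = "excess_overshoot \<eta> K n" and ?e = "tail_error K n"
  have d0: "0 \<le> ?d g" for g by (simp add: excess_overshoot_def)
  have d_ge: "excess K n g / real n - c \<le> ?d g" for g
    unfolding excess_overshoot_def c_def by (rule max.cobounded2)
  have mean: "arc_mean ?P n g \<le> \<eta> * (excess K n g / real n - c) + c + L * ?e g" for g
  proof -
    have "arc_mean ?P n g \<le> \<eta> * (excess K n g / real n) + L * (tail_count K n g / real n)"
      using arc_mean_excess_le[OF \<eta>(1) le, of K n g] by (simp add: L_def add_divide_distrib)
    also have "\<dots> = \<eta> * (excess K n g / real n - c) + L * ?e g + (\<eta> * c + L * tail_weight f K)"
      by (simp add: tail_error_def algebra_simps)
    also have "\<eta> * c + L * tail_weight f K = c" using c by (simp add: \<gamma>_def algebra_simps)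
    finally show ?thesis by simp
  qed
  define y where "y g = max 0 (excess K n g + arc_mean ?P n g - real (Suc n) * c)" for g
  have y_le: "0 \<le> y g" "y g \<le> (real n + \<eta>) * ?d g + \<gamma> * (L * \<bar>?e g\<bar> / \<gamma>)" for g
  proof -
    show "0 \<le> y g" by (simp add: y_def)
    have "excess K n g + arc_mean ?P n g - real (Suc n) * c
        \<le> (real n + \<eta>) * (excess K n g / real n - c) + L * ?e g"
    proof -
      define X where "X = excess K n g / real n"
      have nX: "excess K n g = real n * X" using n1 by (simp add: X_def)
      have "arc_mean ?P n g \<le> \<eta> * (X - c) + c + L * ?e g" using mean[of g] by (simp only: X_def)
      moreover have "(real n + \<eta>) * (X - c) = real n * X - real n * c + \<eta> * (X - c)"
        "real (Suc n) * c = real n * c + c" by (simp_all add: algebra_simps)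
      ultimately show ?thesis unfolding X_def[symmetric] using nX by linarith
    qed
    also have "\<dots> \<le> (real n + \<eta>) * ?d g + L * \<bar>?e g\<bar>"
    proof (rule add_mono)
      show "(real n + \<eta>) * (excess K n g / real n - c) \<le> (real n + \<eta>) * ?d g"
        using \<eta>(1) by (intro mult_left_mono d_ge) simp
      show "L * ?e g \<le> L * \<bar>?e g\<bar>"
        using L by (intro mult_left_mono abs_ge_self) simp
    qed
    finally have "excess K n g + arc_mean ?P n g - real (Suc n) * c \<le> (real n + \<eta>) * ?d g + L * \<bar>?e g\<bar>" .
    moreover have "0 \<le> (real n + \<eta>) * ?d g + L * \<bar>?e g\<bar>"
      using \<eta> L d0[of g] by simp
    ultimately show "y g \<le> (real n + \<eta>) * ?d g + \<gamma> * (L * \<bar>?e g\<bar> / \<gamma>)"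
      using \<gamma> by (simp add: y_def)
  qed
  have y_sq: "(y g)\<^sup>2 \<le> real (Suc n) * ((real n + \<eta>) * (?d g)\<^sup>2 + L\<^sup>2 / \<gamma> * (?e g)\<^sup>2)" for g
  proof -
    have "(y g)\<^sup>2 \<le> ((real n + \<eta>) * ?d g + \<gamma> * (L * \<bar>?e g\<bar> / \<gamma>))\<^sup>2"
      using y_le[of g] by (rule power_mono[rotated])
    also have "\<dots> \<le> real (Suc n) * ((real n + \<eta>) * (?d g)\<^sup>2 + \<gamma> * (L * \<bar>?e g\<bar> / \<gamma>)\<^sup>2)"
      using \<eta> \<gamma> by (intro weighted_square_le) (auto simp: \<gamma>_def)
    also have "\<gamma> * (L * \<bar>?e g\<bar> / \<gamma>)\<^sup>2 = L\<^sup>2 / \<gamma> * (?e g)\<^sup>2"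
      using \<gamma> by (simp add: power2_eq_square)
    finally show ?thesis .
  qed
  have b: "arc_mean ?P n g \<le> \<eta> * (?d g)\<^sup>2 + (\<eta> + c + L)" for g
  proof -
    note d_ge[of g]
    also have "?d g \<le> 1 + (?d g)\<^sup>2"
      using d0[of g] sum_squares_bound[of "?d g" 1] by simp
    finally have "\<eta> * (excess K n g / real n - c) \<le> \<eta> * (1 + (?d g)\<^sup>2)" using \<eta> by (intro mult_left_mono) auto
    moreover have "L * ?e g \<le> L * 1"
      using L tail_error_abs_le_1[of K n g] by (intro mult_left_mono) auto
    ultimately show ?thesis using mean[of g] by (simp add: algebra_simps)
  qed
  have step: "(real (Suc n) * excess_overshoot \<eta> K (Suc n) (G (Suc n) \<omega>))\<^sup>2
     \<le> (y (G n \<omega>) + (excess K (Suc n) (G (Suc n) \<omega>) - excess K n (G n \<omega>)) - arc_mean ?P n (G n \<omega>))\<^sup>2" for \<omega>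
  proof -
    have "real (Suc n) * excess_overshoot \<eta> K (Suc n) (G (Suc n) \<omega>)
      = max 0 (excess K (Suc n) (G (Suc n) \<omega>) - real (Suc n) * c)"
      by (simp add: excess_overshoot_def c_def max_def right_diff_distrib zero_le_mult_iff pos_le_divide_eq
          mult.commute del: of_nat_Suc)
    also have "\<dots> \<le> \<bar>y (G n \<omega>) + (excess K (Suc n) (G (Suc n) \<omega>) - excess K n (G n \<omega>)) - arc_mean ?P n (G n \<omega>)\<bar>"
      unfolding y_def by linarith
    finally have "\<bar>real (Suc n) * excess_overshoot \<eta> K (Suc n) (G (Suc n) \<omega>)\<bar>
       \<le> \<bar>y (G n \<omega>) + (excess K (Suc n) (G (Suc n) \<omega>) - excess K n (G n \<omega>)) - arc_mean ?P n (G n \<omega>)\<bar>"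
      by (simp add: excess_overshoot_def abs_mult del: of_nat_Suc)
    then show ?thesis by (simp only: abs_le_square_iff)
  qed
  have y_int: "integrable M (\<lambda>\<omega>. (y (G n \<omega>) + (excess K (Suc n) (G (Suc n) \<omega>) - excess K n (G n \<omega>)) - arc_mean ?P n (G n \<omega>))\<^sup>2)"
    by (rule integral_condition_on_graph(1)[OF n1, of
          "\<lambda>g \<omega>. (y g + (excess K (Suc n) (G (Suc n) \<omega>) - excess K n g) - arc_mean ?P n g)\<^sup>2"])
      (rule integrable_graph, simp)
  have "(real (Suc n))\<^sup>2 * v (Suc n) = (\<integral>\<omega>. (real (Suc n) * excess_overshoot \<eta> K (Suc n) (G (Suc n) \<omega>))\<^sup>2 \<partial>M)"
    by (simp add: v_def power_mult_distrib del: of_nat_Suc)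
  also have "\<dots> \<le> (\<integral>\<omega>. (y (G n \<omega>) + (excess K (Suc n) (G (Suc n) \<omega>) - excess K n (G n \<omega>)) - arc_mean ?P n (G n \<omega>))\<^sup>2 \<partial>M)"
    by (intro integral_mono step y_int
        integrable_graph[of "Suc n" "\<lambda>g. (real (Suc n) * excess_overshoot \<eta> K (Suc n) g)\<^sup>2"]) simp
  also have "\<dots> \<le> (\<integral>\<omega>. (y (G n \<omega>))\<^sup>2 + arc_mean ?P n (G n \<omega>) \<partial>M)"
    by (rule second_moment_step[where \<phi> = ?\<phi>, OF n1 \<phi>])
  also have "\<dots> \<le> (\<integral>\<omega>. real (Suc n) * ((real n + \<eta>) * (?d (G n \<omega>))\<^sup>2 + L\<^sup>2 / \<gamma> * (?e (G n \<omega>))\<^sup>2)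
      + (\<eta> * (?d (G n \<omega>))\<^sup>2 + (\<eta> + c + L)) \<partial>M)"
    by (intro integral_mono add_mono y_sq b
        integrable_graph[OF n1, of "\<lambda>g. (y g)\<^sup>2 + arc_mean ?P n g"]
        integrable_graph[OF n1, of "\<lambda>g. real (Suc n) * ((real n + \<eta>) * (?d g)\<^sup>2 + L\<^sup>2 / \<gamma> * (?e g)\<^sup>2)
      + (\<eta> * (?d g)\<^sup>2 + (\<eta> + c + L))"])
  also have "\<dots> = real (Suc n) * ((real n + \<eta>) * v n + L\<^sup>2 / \<gamma> * w n) + (\<eta> * v n + (\<eta> + c + L))"
  proof -
    have [simp]: "integrable M (\<lambda>\<omega>. (?d (G n \<omega>))\<^sup>2)" "integrable M (\<lambda>\<omega>. (?e (G n \<omega>))\<^sup>2)"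
      by (rule integrable_graph[OF n1, of "\<lambda>g. (?d g)\<^sup>2"], rule integrable_graph[OF n1, of "\<lambda>g. (?e g)\<^sup>2"])
    show ?thesis by (simp add: v_def w_def prob_space del: of_nat_Suc)
  qed
  finally have "v (Suc n) \<le> (real (Suc n) * ((real n + \<eta>) * v n + L\<^sup>2 / \<gamma> * w n) + (\<eta> * v n + (\<eta> + c + L))) / (real (Suc n))\<^sup>2"
    by (simp add: pos_le_divide_eq mult.commute del: of_nat_Suc)
  also have "\<dots> = ((real n + \<eta>) / real (Suc n) + \<eta> / (real (Suc n))\<^sup>2) * v n
     + (L\<^sup>2 / \<gamma> * (w n / real (Suc n)) + (\<eta> + c + L) / (real (Suc n))\<^sup>2)"
    by (simp add: add_divide_distrib power2_eq_square distrib_right del: of_nat_Suc)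
  also have "\<dots> \<le> (1 - (\<gamma> / 2) / real (Suc n)) * v n
     + (L\<^sup>2 / \<gamma> * (w n / real (Suc n)) + (\<eta> + c + L) / (real (Suc n))\<^sup>2)"
  proof (intro add_right_mono mult_right_mono)
    have "\<eta> \<le> \<gamma> / 2 * real (Suc n)" using n \<gamma> by (simp add: field_simps)
    then have "\<eta> / real (Suc n) \<le> \<gamma> / 2" by (simp add: pos_divide_le_eq del: of_nat_Suc)
    then have "\<eta> / real (Suc n) / real (Suc n) \<le> (\<gamma> / 2) / real (Suc n)"
      by (rule divide_right_mono) simp
    then have "\<eta> / (real (Suc n))\<^sup>2 \<le> (\<gamma> / 2) / real (Suc n)"
      by (simp only: power2_eq_square divide_divide_eq_left)
    moreover have "(real n + \<eta>) / real (Suc n) = 1 - \<gamma> / real (Suc n)"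
      by (simp add: \<gamma>_def field_simps)
    moreover have "\<gamma> / real (Suc n) = 2 * ((\<gamma> / 2) / real (Suc n))" by (simp del: of_nat_Suc)
    ultimately show "(real n + \<eta>) / real (Suc n) + \<eta> / (real (Suc n))\<^sup>2 \<le> 1 - (\<gamma> / 2) / real (Suc n)"
      by linarith
    show "0 \<le> v n" by (simp add: v_def)
  qed
  finally show ?thesis .
qed

lemma AE_excess_le:
  assumes \<eta>: "0 < \<eta>" "\<eta> < 1" and le: "\<And>k. f k \<le> \<eta> * real k + 1"
  shows "AE \<omega> in M. \<forall>K. \<forall>\<epsilon>>0. \<forall>\<^sub>F n in sequentially. excess K n (G n \<omega>) / real n < excess_bound \<eta> K + \<epsilon>"
proof (subst AE_all_countable, rule allI)
  fix K
  define v where "v n = (\<integral>\<omega>. (excess_overshoot \<eta> K n (G n \<omega>))\<^sup>2 \<partial>M)" for n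
  define s where "s n = (\<eta> * real K + 1)\<^sup>2 / (1 - \<eta>) * ((\<integral>\<omega>. (tail_error K n (G n \<omega>))\<^sup>2 \<partial>M) / real (Suc n))
      + (\<eta> + excess_bound \<eta> K + (\<eta> * real K + 1)) / (real (Suc n))\<^sup>2" for n
  have "summable s"
    unfolding s_def by (intro summable_add summable_mult summable_tail_error summable_divide_Suc_square)
  then have "summable (\<lambda>n. v n / real (Suc n))"
  proof (rule summable_of_contracting_recursion[rotated 2])
    show "0 < (1 - \<eta>) / 2" using \<eta> by simp
    show "0 \<le> v n" for n by (simp add: v_def)
    fix n assume "max 1 (nat \<lceil>2 * \<eta> / (1 - \<eta>)\<rceil>) \<le> n"
    then have "1 \<le> n" "2 * \<eta> / (1 - \<eta>) \<le> real n" by linarith+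
    then show "v (Suc n) \<le> (1 - (1 - \<eta>) / 2 / real (Suc n)) * v n + s n"
      unfolding v_def s_def using excess_recursion[OF \<eta> le, of n K] by simp
  qed
  then have "AE \<omega> in M. summable (\<lambda>n. (excess_overshoot \<eta> K n (G n \<omega>))\<^sup>2 / real (Suc n))"
    unfolding v_def by (intro AE_summable_of_summable_expectation) auto
  then show "AE \<omega> in M. \<forall>\<epsilon>>0. \<forall>\<^sub>F n in sequentially. excess K n (G n \<omega>) / real n < excess_bound \<eta> K + \<epsilon>"
  proof (rule AE_mp, intro AE_I2 impI allI)
    fix \<omega> and \<epsilon> :: real
    assume \<omega>: "\<omega> \<in> space M" and sum: "summable (\<lambda>n. (excess_overshoot \<eta> K n (G n \<omega>))\<^sup>2 / real (Suc n))" and "0 < \<epsilon>"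
    show "\<forall>\<^sub>F n in sequentially. excess K n (G n \<omega>) / real n < excess_bound \<eta> K + \<epsilon>"
    proof (rule eventually_upper_of_weighted_summable)
      show "mono (\<lambda>n. excess K n (G n \<omega>))"
        by (rule degree_sum_incseq[OF \<omega>, where P = "\<lambda>z. K \<le> z"]) (auto simp: Suc_diff_le)
      show "0 \<le> excess_bound \<eta> K"
        using \<eta> tail_weight_pos[OF rule, of K] by (simp add: excess_bound_def)
      show "summable (\<lambda>n. (max 0 (excess K n (G n \<omega>) / real n - excess_bound \<eta> K))\<^sup>2 / real (Suc n))"
        using sum by (simp only: excess_overshoot_def)
    qed fact
  qed
qed

lemma excess_bound_tendsto_0:
  assumes "0 < \<eta>" "\<eta> < 1" "\<And>k. f k \<le> \<eta> * real k + 1"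
  shows "excess_bound \<eta> \<longlonglongrightarrow> 0"
proof -
  have sum: "summable (tail_weight f)" by (rule summable_tail_weight[OF rule assms(2,3)])
  have "(\<lambda>K. real K * tail_weight f K) \<longlonglongrightarrow> 0"
    using tail_weight_pos[OF rule] less_imp_le
    by (intro decreasing_summable_imp_mult_tendsto_0[OF tail_weight_antimono[OF rule] _ sum]) blast
  then have "(\<lambda>K. (\<eta> * (real K * tail_weight f K) + tail_weight f K) / (1 - \<eta>)) \<longlonglongrightarrow> (\<eta> * 0 + 0) / (1 - \<eta>)"
    using assms by (intro tendsto_intros summable_LIMSEQ_zero[OF sum]) auto
  then show ?thesis by (simp add: excess_bound_def[abs_def] algebra_simps)
qed

text \<open>
For \<open>z \<ge> 2 * K\<close> the excess \<open>z - K\<close> is at least half of \<open>z\<close>, so it dominates \<open>f z \<le> z + 1\<close> up to a constant.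
\<close>
lemma attachment_le_excess: "1 \<le> K \<Longrightarrow> 2 * K \<le> z \<Longrightarrow> f z \<le> 4 * real (z - K)"
  using f_le[OF rule, of z] by (simp add: of_nat_diff)

lemma degree_sum_attachment_bounds:
  assumes K: "1 \<le> K"
  defines "S \<equiv> \<lambda>n g. \<Sum>k<2*K. f k * (tail_count k n g - tail_count (Suc k) n g)"
  shows "S n g \<le> degree_sum f n g" "degree_sum f n g \<le> S n g + 4 * excess K n g"
proof -
  have S: "S n g = degree_sum (\<lambda>z. if z < 2 * K then f z else 0) n g"
  proof -
    have "(\<lambda>z. if z < 2 * K then f z else 0) = (\<lambda>z. \<Sum>k<2*K. f k * (of_bool (k \<le> z) - of_bool (Suc k \<le> z)))"
    proof
      fix z
      have "(\<Sum>k<2*K. f k * (of_bool (k \<le> z) - of_bool (Suc k \<le> z))) = (\<Sum>k<2*K. if k = z then f k else 0)"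
        by (intro sum.cong) auto
      then show "(if z < 2 * K then f z else 0) = (\<Sum>k<2*K. f k * (of_bool (k \<le> z) - of_bool (Suc k \<le> z)))"
        by simp
    qed
    then show ?thesis
      by (simp only: S_def degree_sum_sum degree_sum_cmult degree_sum_diff)
  qed
  show "S n g \<le> degree_sum f n g"
    unfolding S using f_pos[OF rule] by (intro degree_sum_mono) (simp add: less_imp_le)
  have "degree_sum f n g \<le> degree_sum (\<lambda>z. (if z < 2 * K then f z else 0) + 4 * real (z - K)) n g"
    using attachment_le_excess[OF K] by (intro degree_sum_mono) auto
  then show "degree_sum f n g \<le> S n g + 4 * excess K n g"
    by (simp only: S degree_sum_add degree_sum_cmult)
qed

text \<open>
One factor \<open>f z\<close> is estimated by its largest possible value: below \<open>2 * K\<close> by monotonicity of \<open>f\<close>, and above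
because the excess of a single vertex is at most the total excess. So no square of an indegree
has to be summed.
\<close>
lemma degree_sum_square_le:
  assumes K: "1 \<le> K"
  shows "degree_sum (\<lambda>z. (f z)\<^sup>2) n g \<le> (f (2 * K) + 4 * excess K n g) * degree_sum f n g"
proof -
  have "(f (in_degree (with_proj g) m))\<^sup>2 \<le> (f (2 * K) + 4 * excess K n g) * f (in_degree (with_proj g) m)"
    if m: "m \<in> {1..n}" for m
  proof -
    define z where "z = in_degree (with_proj g) m"
    have ex: "real (z - K) \<le> excess K n g"
      unfolding degree_sum_def z_def using m by (intro member_le_sum) auto
    have "f z \<le> f (2 * K) + 4 * excess K n g"
    proof (cases "2 * K \<le> z")
      case True
      then show ?thesis using attachment_le_excess[OF K True] ex f_pos[OF rule, of "2 * K"] by linarith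
    next
      case False
      then show ?thesis using f_mono[OF rule, of z "2 * K"] ex by linarith
    qed
    then show ?thesis
      using f_pos[OF rule, of z] unfolding z_def[symmetric] power2_eq_square by (intro mult_right_mono) auto
  qed
  then show ?thesis
    unfolding degree_sum_def[of "\<lambda>z. (f z)\<^sup>2"] degree_sum_def[of f] sum_distrib_left by (rule sum_mono)
qed

text \<open>
Truncate at indegree \<open>2 * K\<close>: the truncated sum converges to a partial sum of the series, and the
remainder is at most \<open>4 * excess K n / n\<close>, whose upper limit tends to 0 as \<open>K\<close> grows.
\<close>
lemma mean_attachment_tendsto:
  assumes \<eta>: "0 < \<eta>" "\<eta> < 1" and le: "\<And>k. f k \<le> \<eta> * real k + 1"
    and U: "\<And>k. (\<lambda>n. tail_count k n (g n) / real n) \<longlonglongrightarrow> tail_weight f k"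
    and R: "\<And>K \<epsilon>. 0 < \<epsilon> \<Longrightarrow> \<forall>\<^sub>F n in sequentially. excess K n (g n) / real n < excess_bound \<eta> K + \<epsilon>"
  shows "(\<lambda>n. degree_sum f n (g n) / real n) \<longlonglongrightarrow> (\<Sum>k. limit_weight f k * f k)"
proof -
  define lam where "lam = (\<Sum>k. limit_weight f k * f k)"
  define S where "S K n = (\<Sum>k<2*K. f k * (tail_count k n (g n) / real n - tail_count (Suc k) n (g n) / real n))" for K n
  define T where "T K = (\<Sum>k<2*K. limit_weight f k * f k)" for K
  have sum: "summable (\<lambda>k. limit_weight f k * f k)"
    unfolding limit_weight_times_f[OF rule]
    using summable_tail_weight[OF rule \<eta>(2) le] by (simp add: summable_Suc_iff)
  have "filterlim (\<lambda>K::nat. 2 * K) at_top sequentially"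
    by (rule filterlim_subseq) (simp add: strict_mono_def)
  then have T: "T \<longlonglongrightarrow> lam"
    using summable_LIMSEQ[OF sum] unfolding T_def lam_def by (rule filterlim_compose[rotated])
  have S: "S K \<longlonglongrightarrow> T K" for K
  proof -
    have "S K \<longlonglongrightarrow> (\<Sum>k<2*K. f k * (tail_weight f k - tail_weight f (Suc k)))"
      unfolding S_def by (intro tendsto_intros U)
    then show ?thesis by (simp add: T_def limit_weight_eq_diff[OF rule] mult.commute)
  qed
  have SK: "S K n \<le> degree_sum f n (g n) / real n" "degree_sum f n (g n) / real n \<le> S K n + 4 * (excess K n (g n) / real n)"
    if "1 \<le> K" for K n
  proof -
    have eq: "S K n = (\<Sum>k<2*K. f k * (tail_count k n (g n) - tail_count (Suc k) n (g n))) / real n"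
      by (simp add: S_def sum_divide_distrib diff_divide_distrib[symmetric])
    show "S K n \<le> degree_sum f n (g n) / real n"
      unfolding eq by (intro divide_right_mono degree_sum_attachment_bounds(1) that) simp
    show "degree_sum f n (g n) / real n \<le> S K n + 4 * (excess K n (g n) / real n)"
      using divide_right_mono[OF degree_sum_attachment_bounds(2)[OF that, of n "g n"], of "real n"]
      by (simp add: eq add_divide_distrib)
  qed
  show ?thesis unfolding lam_def[symmetric]
  proof (rule order_tendstoI)
    fix l assume "l < lam"
    then have "\<forall>\<^sub>F K in sequentially. l < T K" by (rule order_tendstoD(1)[OF T])
    from eventually_happens'[OF sequentially_bot eventually_conj[OF eventually_ge_at_top[of 1] this]]
    obtain K where K: "1 \<le> K" "l < T K" by blast
    have "\<forall>\<^sub>F n in sequentially. l < S K n" by (rule order_tendstoD(1)[OF S K(2)])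
    then show "\<forall>\<^sub>F n in sequentially. l < degree_sum f n (g n) / real n"
      by eventually_elim (use SK(1)[OF K(1)] in \<open>meson less_le_trans\<close>)
  next
    fix u assume u: "lam < u"
    \<comment> \<open>one part for the truncated sum and eight for four times an excess below \<open>2 * \<epsilon>\<close>\<close>
    define \<epsilon> where "\<epsilon> = (u - lam) / 9"
    have \<epsilon>: "0 < \<epsilon>" "u = lam + 9 * \<epsilon>" using u by (simp_all add: \<epsilon>_def diff_divide_distrib)
    have "\<forall>\<^sub>F K in sequentially. excess_bound \<eta> K < \<epsilon>"
      using order_tendstoD(2)[OF excess_bound_tendsto_0[OF \<eta> le] \<epsilon>(1)] .
    from eventually_happens'[OF sequentially_bot eventually_conj[OF eventually_ge_at_top[of 1] this]]
    obtain K where K: "1 \<le> K" "excess_bound \<eta> K < \<epsilon>" by blast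
    have "T K \<le> lam"
      unfolding T_def lam_def using limit_weight_pos[OF rule] f_pos[OF rule]
      by (intro sum_le_suminf[OF sum]) (auto intro: less_imp_le mult_pos_pos)
    then have "T K < lam + \<epsilon>" using \<epsilon> by linarith
    then have "\<forall>\<^sub>F n in sequentially. S K n < lam + \<epsilon>" by (rule order_tendstoD(2)[OF S])
    then show "\<forall>\<^sub>F n in sequentially. degree_sum f n (g n) / real n < u"
      using R[OF \<epsilon>(1), of K]
    proof eventually_elim
      case (elim n)
      then show ?case using SK(2)[OF K(1), of n] K(2) \<epsilon> by linarith
    qed
  qed
qed

lemma square_attachment_tendsto_0:
  assumes \<eta>: "0 < \<eta>" "\<eta> < 1" and le: "\<And>k. f k \<le> \<eta> * real k + 1"
    and mean: "(\<lambda>n. degree_sum f n (g n) / real n) \<longlonglongrightarrow> c"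
    and R: "\<And>K \<epsilon>. 0 < \<epsilon> \<Longrightarrow> \<forall>\<^sub>F n in sequentially. excess K n (g n) / real n < excess_bound \<eta> K + \<epsilon>"
  shows "(\<lambda>n. degree_sum (\<lambda>z. (f z)\<^sup>2) n (g n) / (real n)\<^sup>2) \<longlonglongrightarrow> 0"
proof (rule order_tendstoI)
  fix l :: real assume "l < 0"
  then show "\<forall>\<^sub>F n in sequentially. l < degree_sum (\<lambda>z. (f z)\<^sup>2) n (g n) / (real n)\<^sup>2"
    by (intro always_eventually allI) (meson degree_sum_nonneg divide_nonneg_nonneg less_le_trans zero_le_power2)
next
  fix u :: real assume u: "0 < u"
  define B where "B = \<bar>c\<bar> + 1"
  have B: "0 < B" by (simp add: B_def)
  \<comment> \<open>one part for \<open>f (2 * K) / n\<close> and eight for four times an excess below \<open>2 * \<epsilon>\<close>\<close>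
  define \<epsilon> where "\<epsilon> = u / (9 * B)"
  have \<epsilon>: "0 < \<epsilon>" "u = 9 * \<epsilon> * B" using u B by (simp_all add: \<epsilon>_def)
  have "\<forall>\<^sub>F K in sequentially. excess_bound \<eta> K < \<epsilon>"
    using order_tendstoD(2)[OF excess_bound_tendsto_0[OF \<eta> le] \<epsilon>(1)] .
  from eventually_happens'[OF sequentially_bot eventually_conj[OF eventually_ge_at_top[of 1] this]]
  obtain K where K: "1 \<le> K" "excess_bound \<eta> K < \<epsilon>" by blast
  have "(\<lambda>n. f (2 * K) / real n) \<longlonglongrightarrow> 0" by (rule lim_const_over_n)
  then have "\<forall>\<^sub>F n in sequentially. f (2 * K) / real n < \<epsilon>" using \<epsilon>(1) by (rule order_tendstoD(2))
  moreover have "\<forall>\<^sub>F n in sequentially. degree_sum f n (g n) / real n < B"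
    using mean by (rule order_tendstoD(2)) (simp add: B_def)
  ultimately show "\<forall>\<^sub>F n in sequentially. degree_sum (\<lambda>z. (f z)\<^sup>2) n (g n) / (real n)\<^sup>2 < u"
    using R[OF \<epsilon>(1), of K]
  proof eventually_elim
    case (elim n)
    have "degree_sum (\<lambda>z. (f z)\<^sup>2) n (g n) / (real n)\<^sup>2
        \<le> ((f (2 * K) + 4 * excess K n (g n)) * degree_sum f n (g n)) / (real n)\<^sup>2"
      by (intro divide_right_mono degree_sum_square_le K) simp
    also have "\<dots> = (f (2 * K) / real n + 4 * (excess K n (g n) / real n)) * (degree_sum f n (g n) / real n)"
      by (simp add: power2_eq_square flip: add_divide_distrib)
    also have "\<dots> \<le> (9 * \<epsilon>) * (degree_sum f n (g n) / real n)"
      using elim K f_pos[OF rule] by (intro mult_right_mono divide_nonneg_nonneg degree_sum_nonneg) (auto intro: less_imp_le)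
    also have "\<dots> < (9 * \<epsilon>) * B" using elim \<epsilon>(1) by (intro mult_strict_left_mono) auto
    finally show ?case using \<epsilon>(2) by simp
  qed
qed

section \<open>Outdegree of the incoming vertex\<close>

text \<open>
The laws of the arcs are prescribed for graphs of positive probability; almost surely no other
graph occurs, since at each time only finitely many are possible.
\<close>
lemma AE_graph_positive_probability:
  "AE \<omega> in M. \<forall>n\<ge>1. 0 < prob {\<omega>' \<in> space M. G n \<omega>' = G n \<omega>}"
proof (subst AE_all_countable, rule allI, cases)
  fix n :: nat assume n: "1 \<le> n"
  have "AE \<omega> in M. \<forall>g\<in>G n ` space M. G n \<omega> = g \<longrightarrow> 0 < prob {\<omega>' \<in> space M. G n \<omega>' = g}"
  proof (subst AE_finite_all[OF finite_graphs[OF n]], rule ballI)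
    fix g
    show "AE \<omega> in M. G n \<omega> = g \<longrightarrow> 0 < prob {\<omega>' \<in> space M. G n \<omega>' = g}"
    proof (cases "0 < prob {\<omega>' \<in> space M. G n \<omega>' = g}")
      case False
      then have "prob {\<omega>' \<in> space M. G n \<omega>' = g} = 0" by (simp add: not_less measure_le_0_iff)
      then have "{\<omega>' \<in> space M. G n \<omega>' = g} \<in> null_sets M"
        using graph_event_eq[OF n] by (auto simp: null_sets_def emeasure_eq_measure)
      then show ?thesis by (rule AE_not_in[THEN AE_mp]) (auto intro!: AE_I2)
    qed simp
  qed
  then show "AE \<omega> in M. 1 \<le> n \<longrightarrow> 0 < prob {\<omega>' \<in> space M. G n \<omega>' = G n \<omega>}"
    by (rule AE_mp) (auto intro!: AE_I2)
qed simp

lemma outdegree_cond_dist_sums_1_and_Poisson_error: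
  assumes n: "1 \<le> n" and pos: "0 < prob {\<omega>' \<in> space M. G n \<omega>' = G n \<omega>}"
  shows "outdegree_cond_dist M G n \<omega> sums 1"
    and "\<bar>outdegree_cond_dist M G n \<omega> k - poisson_weight (degree_sum f n (G n \<omega>) / real n) k\<bar>
      \<le> 2 * (degree_sum (\<lambda>z. (f z)\<^sup>2) n (G n \<omega>) / (real n)\<^sup>2)"
proof -
  interpret Q: prob_space "given_graph M G n (G n \<omega>)" by (rule prob_space_given_graph[OF n pos])
  have sp: "space (given_graph M G n (G n \<omega>)) = space M" "sets (given_graph M G n (G n \<omega>)) = events"
    by (simp_all add: given_graph_def)
  define N where "N k = {\<omega>' \<in> space (given_graph M G n (G n \<omega>)). card {m \<in> {1..n}. \<omega>' \<in> arc_event M G n m} = k}" for k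
  have eq: "outdegree_cond_dist M G n \<omega> k = Q.prob (N k)" for k
    unfolding outdegree_cond_dist_def sp N_def
    by (intro arg_cong2[where f = measure] refl Collect_cong) (auto simp: out_degree_new_vertex[OF n])
  have ev: "N k \<in> Q.events" for k
    unfolding N_def by (rule sets_Collect_card) (simp_all add: sp(2) arc_event_measurable[OF n])
  have "(\<lambda>k. Q.prob (N k)) sums Q.prob (\<Union>k. N k)"
  proof (rule Q.finite_measure_UNION)
    show "range N \<subseteq> Q.events" using ev by blast
    show "disjoint_family N" unfolding disjoint_family_on_def N_def by blast
  qed
  also have "(\<Union>k. N k) = space (given_graph M G n (G n \<omega>))" unfolding N_def by blast
  finally show "outdegree_cond_dist M G n \<omega> sums 1"
    by (simp add: eq[abs_def] Q.prob_space)
  have p: "Q.prob (arc_event M G n m) = f (in_degree (with_proj (G n \<omega>)) m) / real n" if "m \<in> {1..n}" for m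
    by (rule prob_arc[OF n pos that])
  have "(\<Sum>m=1..n. Q.prob (arc_event M G n m)) = degree_sum f n (G n \<omega>) / real n"
    using p by (simp add: degree_sum_def sum_divide_distrib)
  moreover have "(\<Sum>m=1..n. (Q.prob (arc_event M G n m))\<^sup>2) = degree_sum (\<lambda>z. (f z)\<^sup>2) n (G n \<omega>) / (real n)\<^sup>2"
    using p by (simp add: degree_sum_def sum_divide_distrib power_divide)
  ultimately show "\<bar>outdegree_cond_dist M G n \<omega> k - poisson_weight (degree_sum f n (G n \<omega>) / real n) k\<bar>
      \<le> 2 * (degree_sum (\<lambda>z. (f z)\<^sup>2) n (G n \<omega>) / (real n)\<^sup>2)"
    using Q.le_Cam_pointwise[OF indep_arcs[OF n pos], of "{1..n}" k]
    by (simp only: eq N_def finite_atLeastAtMost subset_refl)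
qed

lemma AE_outdegree_tendsto_Poisson:
  assumes \<eta>: "0 < \<eta>" "\<eta> < 1" and le: "\<And>k. f k \<le> \<eta> * real k + 1"
  shows "summable (\<lambda>k. limit_weight f k * f k)"
    and "AE \<omega> in M. (\<lambda>n. tv_norm (\<lambda>k. outdegree_cond_dist M G n \<omega> k
              - pmf (poisson_pmf (\<Sum>k. limit_weight f k * f k)) k)) \<longlonglongrightarrow> 0"
proof -
  define lam where "lam = (\<Sum>k. limit_weight f k * f k)"
  show sum: "summable (\<lambda>k. limit_weight f k * f k)"
    unfolding limit_weight_times_f[OF rule]
    using summable_tail_weight[OF rule \<eta>(2) le] by (simp add: summable_Suc_iff)
  have lam: "0 < lam"
    unfolding lam_def using limit_weight_pos[OF rule] f_pos[OF rule] by (intro suminf_pos[OF sum]) simp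
  have pmf: "pmf (poisson_pmf lam) k = poisson_weight lam k" for k
    using lam by (simp add: poisson_weight_def)
  have pmf_sums: "poisson_weight lam sums 1"
  proof -
    have "(\<lambda>k. lam ^ k /\<^sub>R fact k * exp (- lam)) sums (exp lam * exp (- lam))"
      by (intro sums_mult2 exp_converges)
    then show ?thesis
      by (simp add: poisson_weight_def[abs_def] divide_inverse mult.commute exp_minus_inverse)
  qed
  have "AE \<omega> in M. (\<lambda>n. tv_norm (\<lambda>k. outdegree_cond_dist M G n \<omega> k - poisson_weight lam k)) \<longlonglongrightarrow> 0"
    using AE_tail_frequency AE_excess_le[OF \<eta> le] AE_graph_positive_probability
  proof eventually_elim
    case (elim \<omega>)
    have mean: "(\<lambda>n. degree_sum f n (G n \<omega>) / real n) \<longlonglongrightarrow> lam"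
      unfolding lam_def using elim by (intro mean_attachment_tendsto[OF \<eta> le]) auto
    have sq: "(\<lambda>n. degree_sum (\<lambda>z. (f z)\<^sup>2) n (G n \<omega>) / (real n)\<^sup>2) \<longlonglongrightarrow> 0"
      using elim by (intro square_attachment_tendsto_0[OF \<eta> le mean]) auto
    have "(\<lambda>n. tv_norm (\<lambda>k. outdegree_cond_dist M G (Suc n) \<omega> k - poisson_weight lam k)) \<longlonglongrightarrow> 0"
    proof (rule tv_norm_tendsto_0_Scheffe)
      show "0 \<le> outdegree_cond_dist M G (Suc n) \<omega> k" for n k
        by (simp add: outdegree_cond_dist_def)
      show "0 \<le> poisson_weight lam k" for k using lam by (simp add: poisson_weight_bounds)
      show "outdegree_cond_dist M G (Suc n) \<omega> sums 1" for n
        using elim by (intro outdegree_cond_dist_sums_1_and_Poisson_error) auto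
      show "poisson_weight lam sums 1" by (rule pmf_sums)
      fix k
      have wt: "(\<lambda>n. poisson_weight (degree_sum f n (G n \<omega>) / real n) k) \<longlonglongrightarrow> poisson_weight lam k"
        unfolding poisson_weight_def by (intro tendsto_intros mean) simp
      have diff: "(\<lambda>n. outdegree_cond_dist M G n \<omega> k - poisson_weight (degree_sum f n (G n \<omega>) / real n) k) \<longlonglongrightarrow> 0"
      proof (rule Lim_null_comparison)
        show "\<forall>\<^sub>F n in sequentially. norm (outdegree_cond_dist M G n \<omega> k - poisson_weight (degree_sum f n (G n \<omega>) / real n) k)
           \<le> 2 * (degree_sum (\<lambda>z. (f z)\<^sup>2) n (G n \<omega>) / (real n)\<^sup>2)"
          using elim outdegree_cond_dist_sums_1_and_Poisson_error(2)
          by (intro eventually_sequentiallyI[of 1]) auto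
        show "(\<lambda>n. 2 * (degree_sum (\<lambda>z. (f z)\<^sup>2) n (G n \<omega>) / (real n)\<^sup>2)) \<longlonglongrightarrow> 0"
          using tendsto_mult[OF tendsto_const[of 2] sq] by simp
      qed
      have "(\<lambda>n. outdegree_cond_dist M G n \<omega> k) \<longlonglongrightarrow> poisson_weight lam k"
        using tendsto_add[OF diff wt] by simp
      then show "(\<lambda>n. outdegree_cond_dist M G (Suc n) \<omega> k) \<longlonglongrightarrow> poisson_weight lam k"
        by (rule LIMSEQ_Suc)
    qed
    then show ?case by (rule LIMSEQ_imp_Suc)
  qed
  then show "AE \<omega> in M. (\<lambda>n. tv_norm (\<lambda>k. outdegree_cond_dist M G n \<omega> k
              - pmf (poisson_pmf (\<Sum>k. limit_weight f k * f k)) k)) \<longlonglongrightarrow> 0"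
    by (simp only: lam_def[symmetric] pmf)
qed

end

section \<open>The limit theorem\<close>

theorem theorem1p1:
  fixes M :: "'w measure"
    and f :: "nat \<Rightarrow> real"
    and G :: "nat \<Rightarrow> 'w \<Rightarrow> nat pair_pre_digraph"
  assumes "attachment_rule f"
    and "preferential_attachment M f G"
  shows "((\<forall>k. 0 \<le> limit_weight f k) \<and> limit_weight f sums 1 \<and>
          (AE \<omega> in M. (\<lambda>n. tv_norm (\<lambda>k. empirical_indegree G n \<omega> k - limit_weight f k)) \<longlonglongrightarrow> 0)) \<and>
         (\<forall>\<eta>::real. 0 < \<eta> \<and> \<eta> < 1 \<and> (\<forall>k. f k \<le> \<eta> * real k + 1) \<longrightarrow>
          summable (\<lambda>k. limit_weight f k * f k) \<and>
          (AE \<omega> in M. (\<lambda>n. tv_norm (\<lambda>k. outdegree_cond_dist M G n \<omega> k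
              - pmf (poisson_pmf (\<Sum>k. limit_weight f k * f k)) k)) \<longlonglongrightarrow> 0))"
proof -
  interpret attachment_network M f G
    using assms by (simp add: attachment_network_def attachment_network_axioms_def)
  show ?thesis
  proof (intro conjI allI impI)
    show "0 \<le> limit_weight f k" for k using limit_weight_pos[OF rule, of k] by simp
    show "limit_weight f sums 1" by (rule limit_weight_sums_1[OF rule])
    show "AE \<omega> in M. (\<lambda>n. tv_norm (\<lambda>k. empirical_indegree G n \<omega> k - limit_weight f k)) \<longlonglongrightarrow> 0"
      by (rule AE_empirical_indegree_tendsto)
    fix \<eta> :: real assume "0 < \<eta> \<and> \<eta> < 1 \<and> (\<forall>k. f k \<le> \<eta> * real k + 1)"
    then have \<eta>: "0 < \<eta>" "\<eta> < 1" "f k \<le> \<eta> * real k + 1" for k by auto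
    show "summable (\<lambda>k. limit_weight f k * f k)" by (rule AE_outdegree_tendsto_Poisson(1)[OF \<eta>])
    show "AE \<omega> in M. (\<lambda>n. tv_norm (\<lambda>k. outdegree_cond_dist M G n \<omega> k
              - pmf (poisson_pmf (\<Sum>k. limit_weight f k * f k)) k)) \<longlonglongrightarrow> 0"
      by (rule AE_outdegree_tendsto_Poisson(2)[OF \<eta>])
  qed
qed

end
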